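(* Let $(G,\rho)$ be a unimodular random rooted graph such that $G$ is almost surely recurrent and $\mathbb{E}[\deg(\rho)]<\infty$. Then, almost surely, $G$ has the infinite collision property.
   Context: A rooted graph $(G,\rho)$ is a connected, locally finite (multi)graph $G=(V,E)$ (loops and multiple edges allowed) together with a distinguished vertex $\rho\in V$, the root. Isomorphisms of rooted graphs are graph isomorphisms mapping root to root. The set of isomorphism classes of rooted graphs carries the local topology, in which two rooted graphs are close if and only if they have isomorphic balls of large radius around their roots; a random rooted graph is a random variable with values in this space. A doubly-rooted graph is a connected, locally finite graph with an ordered pair of (not necessarily distinct) distinguished vertices; the space $\mathcal{G}_{\bullet\bullet}$ of isomorphism classes of doubly-rooted graphs is topologized in the same way. A mass transport is a Borel measurable function $f:\mathcal{G}_{\bullet\bullet}\to[0,\infty]$. A random rooted graph $(G,\rho)$ is unimodular if it satisfies the Mass-Transport Principle: for every mass transport $f$, $$\mathbb{E}\Big[\sum_{v\in V} f(G,\rho,v)\Big]=\mathbb{E}\Big[\sum_{u\in V} f(G,u,\rho)\Big].$$ $\deg(u)$ is the number of edges emanating from $u$. The simple random walk on $G$ is the Markov chain $\langle X_n\rangle_{n\ge 0}$ on $V$ with transition probabilities $p(u,v)$ equal to the fraction of edges emanating from $u$ that end in $v$. (If $G$ is a single vertex with no edges, the walk stays there.) $G$ is recurrent if simple random walk on $G$ is recurrent. A connected, locally finite graph $G$ has the infinite collision property if for every vertex $v$ of $G$, two independent simple random walks $\langle X_n\rangle_{n\geq 0}$ and $\langle Y_n\rangle_{n\ge 0}$ on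 $G$ both started from $v$ almost surely satisfy $X_n=Y_n$ for infinitely many $n$. *)

theory Defs
  imports "HOL-Probability.Probability"
begin

section \<open>Multigraphs\<close>

text \<open>\<open>nedges G u v\<close> is the number of edges joining \<open>u\<close> and \<open>v\<close>. A loop is one edge emanating
  from its vertex and contributes one to the degree; the convention in which loops count
  twice is obtained by doubling \<open>nedges G u u\<close>.\<close>

record 'v multigraph =
  verts :: "'v set"
  nedges :: "'v \<Rightarrow> 'v \<Rightarrow> nat"

definition wf_multigraph :: "'v multigraph \<Rightarrow> bool" where
  "wf_multigraph G \<longleftrightarrow>
     (\<forall>u v. nedges G u v = nedges G v u) \<and> (\<forall>u v. nedges G u v > 0 \<longrightarrow> u \<in> verts G \<and> v \<in> verts G)"

definition adj :: "'v multigraph \<Rightarrow> 'v rel" where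
  "adj G = {(u, v). nedges G u v > 0}"

definition locally_finite :: "'v multigraph \<Rightarrow> bool" where
  "locally_finite G \<longleftrightarrow> (\<forall>u\<in>verts G. finite {v. nedges G u v > 0})"

definition connected_graph :: "'v multigraph \<Rightarrow> bool" where
  "connected_graph G \<longleftrightarrow> verts G \<noteq> {} \<and> (\<forall>u\<in>verts G. \<forall>v\<in>verts G. (u, v) \<in> (adj G)\<^sup>*)"

definition conn_lf_graph :: "'v multigraph \<Rightarrow> bool" where
  "conn_lf_graph G \<longleftrightarrow> wf_multigraph G \<and> locally_finite G \<and> connected_graph G"

definition deg :: "'v multigraph \<Rightarrow> 'v \<Rightarrow> nat" where
  "deg G u = (\<Sum>v | nedges G u v > 0. nedges G u v)"

definition graph_iso :: "('v \<Rightarrow> 'w) \<Rightarrow> 'v multigraph \<Rightarrow> 'w multigraph \<Rightarrow> bool" where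
  "graph_iso \<phi> G H \<longleftrightarrow> bij_betw \<phi> (verts G) (verts H) \<and>
     (\<forall>u\<in>verts G. \<forall>v\<in>verts G. nedges H (\<phi> u) (\<phi> v) = nedges G u v)"

definition rooted_iso :: "'v multigraph \<Rightarrow> 'v list \<Rightarrow> 'w multigraph \<Rightarrow> 'w list \<Rightarrow> bool" where
  "rooted_iso G us H vs \<longleftrightarrow> (\<exists>\<phi>. graph_iso \<phi> G H \<and> map \<phi> us = vs)"

definition ball_verts :: "'v multigraph \<Rightarrow> 'v list \<Rightarrow> nat \<Rightarrow> 'v set" where
  "ball_verts G us r = {v\<in>verts G. \<exists>u\<in>set us. \<exists>n\<le>r. (u, v) \<in> adj G ^^ n}"

definition graph_ball :: "'v multigraph \<Rightarrow> 'v list \<Rightarrow> nat \<Rightarrow> 'v multigraph" where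
  "graph_ball G us r = (let B = ball_verts G us r in
     \<lparr>verts = B, nedges = (\<lambda>u v. if u \<in> B \<and> v \<in> B then nedges G u v else 0)\<rparr>)"

lemma rooted_iso_refl: "rooted_iso G us G us"
  unfolding rooted_iso_def graph_iso_def by (rule exI[of _ id]) auto

lemma graph_iso_inv:
  assumes "graph_iso \<phi> G H"
  shows "graph_iso (inv_into (verts G) \<phi>) H G"
proof -
  let ?\<psi> = "inv_into (verts G) \<phi>"
  have bij: "bij_betw \<phi> (verts G) (verts H)"
    and m: "\<And>u v. u \<in> verts G \<Longrightarrow> v \<in> verts G \<Longrightarrow> nedges H (\<phi> u) (\<phi> v) = nedges G u v"
    using assms by (auto simp: graph_iso_def)
  have "bij_betw ?\<psi> (verts H) (verts G)" using bij by (rule bij_betw_inv_into)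
  moreover have "nedges G (?\<psi> u) (?\<psi> v) = nedges H u v" if "u \<in> verts H" "v \<in> verts H" for u v
    using m[of "?\<psi> u" "?\<psi> v"] that bij by (auto simp: bij_betw_def inv_into_into f_inv_into_f)
  ultimately show ?thesis unfolding graph_iso_def by blast
qed

lemma map_inv_into_roots:
  assumes "inj_on \<phi> A" "set us \<subseteq> A"
  shows "map (inv_into A \<phi>) (map \<phi> us) = us"
  using assms by (auto intro!: map_idI)

lemma rooted_iso_sym:
  assumes "rooted_iso G us H vs" "set us \<subseteq> verts G"
  shows "rooted_iso H vs G us"
proof -
  obtain \<phi> where \<phi>: "graph_iso \<phi> G H" "map \<phi> us = vs"
    using assms(1) by (auto simp: rooted_iso_def)
  then have "inj_on \<phi> (verts G)" by (auto simp: graph_iso_def bij_betw_def)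
  then have "map (inv_into (verts G) \<phi>) vs = us"
    using map_inv_into_roots assms(2) \<phi>(2) by blast
  with graph_iso_inv[OF \<phi>(1)] show ?thesis unfolding rooted_iso_def by blast
qed

lemma rooted_iso_trans:
  assumes "rooted_iso G us H vs" "rooted_iso H vs K ws"
  shows "rooted_iso G us K ws"
proof -
  obtain \<phi> where 1: "graph_iso \<phi> G H" "map \<phi> us = vs" using assms(1) by (auto simp: rooted_iso_def)
  obtain \<psi> where 2: "graph_iso \<psi> H K" "map \<psi> vs = ws" using assms(2) by (auto simp: rooted_iso_def)
  have "graph_iso (\<psi> \<circ> \<phi>) G K"
    using 1(1) 2(1) bij_betw_apply[of \<phi> "verts G" "verts H"]
    by (auto simp: graph_iso_def intro: bij_betw_trans)
  moreover have "map (\<psi> \<circ> \<phi>) us = ws" using 1 2 by auto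
  ultimately show ?thesis unfolding rooted_iso_def by blast
qed

lemma ball_verts_iso:
  assumes "graph_iso \<phi> (graph_ball G us r) (graph_ball H (map \<phi> us) r)" "wf_multigraph H"
    and "(u, v) \<in> adj G ^^ n" "u \<in> set us" "n \<le> r" "wf_multigraph G" "u \<in> verts G"
  shows "v \<in> ball_verts G us r \<and> \<phi> v \<in> verts H \<and> (\<phi> u, \<phi> v) \<in> adj H ^^ n"
  using assms(3,5)
proof (induction n arbitrary: v)
  case 0
  then have *: "v \<in> ball_verts G us r"
    using assms(4,7) by (auto simp: ball_verts_def intro!: bexI[of _ u] exI[of _ 0])
  then have "\<phi> v \<in> ball_verts H (map \<phi> us) r"
    using assms(1) bij_betw_apply by (fastforce simp: graph_iso_def graph_ball_def Let_def)
  with * 0 show ?case by (auto simp: ball_verts_def)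
next
  case (Suc n)
  then obtain w where w: "(u, w) \<in> adj G ^^ n" "(w, v) \<in> adj G" by auto
  have IH: "w \<in> ball_verts G us r" "(\<phi> u, \<phi> w) \<in> adj H ^^ n" using Suc.IH[OF w(1)] Suc.prems by auto
  have "v \<in> verts G" using w(2) assms(6) by (auto simp: adj_def wf_multigraph_def)
  then have v: "v \<in> ball_verts G us r"
    using Suc.prems assms(4) by (auto simp: ball_verts_def intro!: bexI[of _ u] exI[of _ "Suc n"])
  have b: "\<phi> v \<in> ball_verts H (map \<phi> us) r" "\<phi> w \<in> ball_verts H (map \<phi> us) r"
    using assms(1) v IH(1) bij_betw_apply by (fastforce simp: graph_iso_def graph_ball_def Let_def)+
  have "nedges H (\<phi> w) (\<phi> v) = nedges G w v"
    using assms(1) v IH(1) b unfolding graph_iso_def graph_ball_def Let_def by simp metis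
  then have "(\<phi> w, \<phi> v) \<in> adj H" using w(2) by (auto simp: adj_def)
  with IH v b show ?case by (auto simp: ball_verts_def)
qed

lemma graph_ball_iso_verts_mono:
  assumes iso: "graph_iso \<phi> (graph_ball G us r) (graph_ball H (map \<phi> us) r)"
    and wf: "wf_multigraph G" "wf_multigraph H" and us: "set us \<subseteq> verts G" and "s \<le> r"
  shows "\<phi> ` ball_verts G us s \<subseteq> ball_verts H (map \<phi> us) s"
proof
  fix y assume "y \<in> \<phi> ` ball_verts G us s"
  then obtain v u n where "y = \<phi> v" "u \<in> set us" "n \<le> s" "(u, v) \<in> adj G ^^ n"
    by (auto simp: ball_verts_def)
  with ball_verts_iso[OF iso wf(2), of u v n] us wf(1) \<open>s \<le> r\<close>
  show "y \<in> ball_verts H (map \<phi> us) s" by (auto simp: ball_verts_def)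
qed

lemma rooted_iso_ball_mono:
  assumes iso: "rooted_iso (graph_ball G us r) us (graph_ball H vs r) vs"
    and wf: "wf_multigraph G" "wf_multigraph H" and us: "set us \<subseteq> verts G" "set vs \<subseteq> verts H"
    and "s \<le> r"
  shows "rooted_iso (graph_ball G us s) us (graph_ball H vs s) vs"
proof -
  let ?B = "ball_verts G us" and ?C = "ball_verts H vs"
  have V: "verts (graph_ball G us i) = ?B i" "verts (graph_ball H vs i) = ?C i" for i
    by (auto simp: graph_ball_def Let_def)
  have E: "nedges (graph_ball G us i) u v = (if u \<in> ?B i \<and> v \<in> ?B i then nedges G u v else 0)"
    "nedges (graph_ball H vs i) x y = (if x \<in> ?C i \<and> y \<in> ?C i then nedges H x y else 0)" for i u v x y
    by (auto simp: graph_ball_def Let_def)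
  obtain \<phi> where \<phi>: "graph_iso \<phi> (graph_ball G us r) (graph_ball H vs r)" and vs: "map \<phi> us = vs"
    using iso by (auto simp: rooted_iso_def)
  define \<psi> where "\<psi> = inv_into (?B r) \<phi>"
  have bij: "bij_betw \<phi> (?B r) (?C r)" using \<phi> by (simp add: graph_iso_def V)
  have sub: "?B s \<subseteq> ?B r" "?C s \<subseteq> ?C r" using \<open>s \<le> r\<close> by (auto simp: ball_verts_def) (meson order_trans)+
  have "set us \<subseteq> ?B r" using us(1) by (force simp: ball_verts_def)
  then have us': "map \<psi> vs = us"
    using map_inv_into_roots bij unfolding vs[symmetric] \<psi>_def bij_betw_def by blast
  have "graph_iso \<psi> (graph_ball H vs r) (graph_ball G us r)"
    using graph_iso_inv[OF \<phi>] by (simp add: V \<psi>_def)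
  then have \<psi>: "\<psi> ` ?C s \<subseteq> ?B s"
    using graph_ball_iso_verts_mono[of \<psi> H vs r G s] us' wf us \<open>s \<le> r\<close> by simp
  have "\<phi> ` ?B s \<subseteq> ?C s"
    using graph_ball_iso_verts_mono[of \<phi> G us r H s] \<phi> vs wf us \<open>s \<le> r\<close> by simp
  moreover have "?C s \<subseteq> \<phi> ` ?B s"
  proof
    fix y assume "y \<in> ?C s"
    then have "\<psi> y \<in> ?B s" "\<phi> (\<psi> y) = y"
      using \<psi> sub bij by (auto simp: \<psi>_def bij_betw_def f_inv_into_f subset_iff)
    then show "y \<in> \<phi> ` ?B s" by force
  qed
  ultimately have "\<phi> ` ?B s = ?C s" by blast
  moreover from this have "bij_betw \<phi> (?B s) (?C s)"
    using bij sub(1) by (auto simp: bij_betw_def intro: inj_on_subset)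
  moreover have "nedges H (\<phi> u) (\<phi> v) = nedges G u v" if "u \<in> ?B s" "v \<in> ?B s" for u v
  proof -
    have "u \<in> ?B r" "v \<in> ?B r" using that sub by auto
    moreover from this have "\<phi> u \<in> ?C r" "\<phi> v \<in> ?C r" using bij by (auto simp: bij_betw_def)
    ultimately show ?thesis using \<phi> unfolding graph_iso_def V E by metis
  qed
  ultimately have "graph_iso \<phi> (graph_ball G us s) (graph_ball H vs s)"
    unfolding graph_iso_def V E by auto
  then show ?thesis using vs unfolding rooted_iso_def by blast
qed

section \<open>The spaces of rooted and doubly-rooted graphs\<close>

text \<open>Connected locally finite graphs are countable, so every isomorphism class has a
  representative whose vertices are natural numbers.\<close>

definition rooted_equiv :: "nat multigraph \<times> nat \<Rightarrow> nat multigraph \<times> nat \<Rightarrow> bool" where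
  "rooted_equiv = (\<lambda>(G, u) (H, v). conn_lf_graph G \<and> conn_lf_graph H \<and>
     u \<in> verts G \<and> v \<in> verts H \<and> rooted_iso G [u] H [v])"

definition birooted_equiv ::
    "nat multigraph \<times> nat \<times> nat \<Rightarrow> nat multigraph \<times> nat \<times> nat \<Rightarrow> bool" where
  "birooted_equiv = (\<lambda>(G, u, v) (H, x, y). conn_lf_graph G \<and> conn_lf_graph H \<and>
     u \<in> verts G \<and> v \<in> verts G \<and> x \<in> verts H \<and> y \<in> verts H \<and> rooted_iso G [u, v] H [x, y])"

lemma conn_lf_graph_singleton: "conn_lf_graph \<lparr>verts = {u}, nedges = (\<lambda>_ _. 0)\<rparr>"
  by (auto simp: conn_lf_graph_def wf_multigraph_def locally_finite_def connected_graph_def)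

quotient_type rooted_graph = "nat multigraph \<times> nat" / partial: rooted_equiv
proof (rule part_equivpI)
  show "\<exists>x. rooted_equiv x x"
    using conn_lf_graph_singleton[of "0::nat"] rooted_iso_refl
    by (intro exI[of _ "(\<lparr>verts = {0}, nedges = (\<lambda>_ _. 0)\<rparr>, 0)"]) (auto simp: rooted_equiv_def)
  show "symp rooted_equiv"
    by (rule sympI) (auto simp: rooted_equiv_def intro: rooted_iso_sym)
  show "transp rooted_equiv"
    by (rule transpI) (auto simp: rooted_equiv_def intro: rooted_iso_trans)
qed

quotient_type birooted_graph = "nat multigraph \<times> nat \<times> nat" / partial: birooted_equiv
proof (rule part_equivpI)
  show "\<exists>x. birooted_equiv x x"
    using conn_lf_graph_singleton[of "0::nat"] rooted_iso_refl
    by (intro exI[of _ "(\<lparr>verts = {0}, nedges = (\<lambda>_ _. 0)\<rparr>, 0, 0)"]) (auto simp: birooted_equiv_def)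
  show "symp birooted_equiv"
    by (rule sympI) (auto simp: birooted_equiv_def intro: rooted_iso_sym)
  show "transp birooted_equiv"
    by (rule transpI) (auto simp: birooted_equiv_def intro: rooted_iso_trans)
qed

text \<open>A chosen representative of an isomorphism class. Everything below that is applied to it
  is invariant under isomorphism.\<close>

definition graph_of :: "rooted_graph \<Rightarrow> nat multigraph" where
  "graph_of x = fst (rep_rooted_graph x)"

definition root_of :: "rooted_graph \<Rightarrow> nat" where
  "root_of x = snd (rep_rooted_graph x)"

definition birooted :: "nat multigraph \<Rightarrow> nat \<Rightarrow> nat \<Rightarrow> birooted_graph" where
  "birooted G u v = abs_birooted_graph (G, u, v)"

lemma graph_of_root_of: "conn_lf_graph (graph_of x)" "root_of x \<in> verts (graph_of x)"
  using Quotient3_rep_reflp[OF Quotient3_rooted_graph, of x]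
  by (auto simp: rooted_equiv_def graph_of_def root_of_def split: prod.splits)

lemma rep_birooted_graph_wf:
  "case rep_birooted_graph x of (G, u, v) \<Rightarrow> conn_lf_graph G \<and> u \<in> verts G \<and> v \<in> verts G"
  using Quotient3_rep_reflp[OF Quotient3_birooted_graph, of x]
  by (auto simp: birooted_equiv_def)

definition rooted_balls_iso :: "nat \<Rightarrow> rooted_graph \<Rightarrow> rooted_graph \<Rightarrow> bool" where
  "rooted_balls_iso r x y =
     (case rep_rooted_graph x of (G, u) \<Rightarrow> case rep_rooted_graph y of (H, v) \<Rightarrow>
        rooted_iso (graph_ball G [u] r) [u] (graph_ball H [v] r) [v])"

definition birooted_balls_iso :: "nat \<Rightarrow> birooted_graph \<Rightarrow> birooted_graph \<Rightarrow> bool" where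
  "birooted_balls_iso r x y =
     (case rep_birooted_graph x of (G, us) \<Rightarrow> case rep_birooted_graph y of (H, vs) \<Rightarrow>
        (case (us, vs) of ((u, u'), (v, v')) \<Rightarrow>
          rooted_iso (graph_ball G [u, u'] r) [u, u'] (graph_ball H [v, v'] r) [v, v']))"

lemma rooted_balls_iso_mono: "rooted_balls_iso r x y \<Longrightarrow> s \<le> r \<Longrightarrow> rooted_balls_iso s x y"
  using graph_of_root_of[of x] graph_of_root_of[of y]
  by (auto simp: rooted_balls_iso_def graph_of_def root_of_def conn_lf_graph_def
      split: prod.splits intro: rooted_iso_ball_mono)

lemma birooted_balls_iso_mono: "birooted_balls_iso r x y \<Longrightarrow> s \<le> r \<Longrightarrow> birooted_balls_iso s x y"
  using rep_birooted_graph_wf[of x] rep_birooted_graph_wf[of y]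
  by (auto simp: birooted_balls_iso_def conn_lf_graph_def
      split: prod.splits intro: rooted_iso_ball_mono)

text \<open>The local topology. For doubly-rooted graphs, balls are taken around the pair of roots;
  for radii exceeding the distance of the roots this agrees with balls around either root.\<close>

instantiation rooted_graph :: topological_space
begin

definition open_rooted_graph :: "rooted_graph set \<Rightarrow> bool" where
  "open_rooted_graph U \<longleftrightarrow> (\<forall>x\<in>U. \<exists>r. \<forall>y. rooted_balls_iso r x y \<longrightarrow> y \<in> U)"

instance
proof
  show "open (UNIV :: rooted_graph set)" by (simp add: open_rooted_graph_def)
next
  fix S T :: "rooted_graph set" assume ST: "open S" "open T"
  show "open (S \<inter> T)" unfolding open_rooted_graph_def
  proof
    fix x assume "x \<in> S \<inter> T"
    with ST obtain r s where r: "\<forall>y. rooted_balls_iso r x y \<longrightarrow> y \<in> S"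
      and s: "\<forall>y. rooted_balls_iso s x y \<longrightarrow> y \<in> T"
      unfolding open_rooted_graph_def by blast
    show "\<exists>r. \<forall>y. rooted_balls_iso r x y \<longrightarrow> y \<in> S \<inter> T"
    proof (intro exI allI impI)
      fix y assume "rooted_balls_iso (max r s) x y"
      then have "rooted_balls_iso r x y" and "rooted_balls_iso s x y"
        by (rule rooted_balls_iso_mono, simp)+
      with r s show "y \<in> S \<inter> T" by blast
    qed
  qed
next
  fix K :: "rooted_graph set set" assume "\<forall>S\<in>K. open S"
  show "open (\<Union>K)" unfolding open_rooted_graph_def
  proof
    fix x assume "x \<in> \<Union>K"
    then obtain S where S: "S \<in> K" "x \<in> S" by blast
    with \<open>\<forall>S\<in>K. open S\<close> have "open S" by blast
    with S(2) obtain r where "\<forall>y. rooted_balls_iso r x y \<longrightarrow> y \<in> S"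
      unfolding open_rooted_graph_def by blast
    with S(1) show "\<exists>r. \<forall>y. rooted_balls_iso r x y \<longrightarrow> y \<in> \<Union>K" by blast
  qed
qed

end

instantiation birooted_graph :: topological_space
begin

definition open_birooted_graph :: "birooted_graph set \<Rightarrow> bool" where
  "open_birooted_graph U \<longleftrightarrow> (\<forall>x\<in>U. \<exists>r. \<forall>y. birooted_balls_iso r x y \<longrightarrow> y \<in> U)"

instance
proof
  show "open (UNIV :: birooted_graph set)" by (simp add: open_birooted_graph_def)
next
  fix S T :: "birooted_graph set" assume ST: "open S" "open T"
  show "open (S \<inter> T)" unfolding open_birooted_graph_def
  proof
    fix x assume "x \<in> S \<inter> T"
    with ST obtain r s where r: "\<forall>y. birooted_balls_iso r x y \<longrightarrow> y \<in> S"
      and s: "\<forall>y. birooted_balls_iso s x y \<longrightarrow> y \<in> T"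
      unfolding open_birooted_graph_def by blast
    show "\<exists>r. \<forall>y. birooted_balls_iso r x y \<longrightarrow> y \<in> S \<inter> T"
    proof (intro exI allI impI)
      fix y assume "birooted_balls_iso (max r s) x y"
      then have "birooted_balls_iso r x y" and "birooted_balls_iso s x y"
        by (rule birooted_balls_iso_mono, simp)+
      with r s show "y \<in> S \<inter> T" by blast
    qed
  qed
next
  fix K :: "birooted_graph set set" assume "\<forall>S\<in>K. open S"
  show "open (\<Union>K)" unfolding open_birooted_graph_def
  proof
    fix x assume "x \<in> \<Union>K"
    then obtain S where S: "S \<in> K" "x \<in> S" by blast
    with \<open>\<forall>S\<in>K. open S\<close> have "open S" by blast
    with S(2) obtain r where "\<forall>y. birooted_balls_iso r x y \<longrightarrow> y \<in> S"
      unfolding open_birooted_graph_def by blast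
    with S(1) show "\<exists>r. \<forall>y. birooted_balls_iso r x y \<longrightarrow> y \<in> \<Union>K" by blast
  qed
qed

end

section \<open>Unimodularity\<close>

definition random_rooted_graph :: "'w measure \<Rightarrow> ('w \<Rightarrow> rooted_graph) \<Rightarrow> bool" where
  "random_rooted_graph M X \<longleftrightarrow> prob_space M \<and> X \<in> borel_measurable M"

definition unimodular :: "'w measure \<Rightarrow> ('w \<Rightarrow> rooted_graph) \<Rightarrow> bool" where
  "unimodular M X \<longleftrightarrow> (\<forall>f :: birooted_graph \<Rightarrow> ennreal. f \<in> borel_measurable borel \<longrightarrow>
     (\<integral>\<^sup>+\<omega>. (\<integral>\<^sup>+v. f (birooted (graph_of (X \<omega>)) (root_of (X \<omega>)) v) \<partial>count_space (verts (graph_of (X \<omega>)))) \<partial>M) =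
     (\<integral>\<^sup>+\<omega>. (\<integral>\<^sup>+u. f (birooted (graph_of (X \<omega>)) u (root_of (X \<omega>))) \<partial>count_space (verts (graph_of (X \<omega>)))) \<partial>M))"

section \<open>Simple random walk\<close>

definition srw_step :: "'v multigraph \<Rightarrow> 'v \<Rightarrow> 'v pmf" where
  "srw_step G u = (if deg G u = 0 then return_pmf u else embed_pmf (\<lambda>v. nedges G u v / deg G u))"

lemma pmf_srw_step:
  assumes "finite {v. nedges G u v > 0}" "deg G u \<noteq> 0"
  shows "pmf (srw_step G u) v = nedges G u v / deg G u"
proof -
  have "(\<integral>\<^sup>+v. ennreal (nedges G u v / deg G u) \<partial>count_space UNIV)
      = (\<integral>\<^sup>+v. ennreal (nedges G u v / deg G u) \<partial>count_space {v. nedges G u v > 0})"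
    by (intro nn_integral_count_space_eq) auto
  also have "\<dots> = (\<Sum>v | nedges G u v > 0. ennreal (nedges G u v / deg G u))"
    by (rule nn_integral_count_space_finite[OF assms(1)])
  also have "\<dots> = ennreal ((\<Sum>v | nedges G u v > 0. real (nedges G u v)) / deg G u)"
    by (subst sum_ennreal) (auto simp: sum_divide_distrib)
  also have "\<dots> = 1"
    using assms(2) unfolding deg_def of_nat_sum[symmetric] by (simp del: of_nat_sum)
  finally show ?thesis using assms(2) by (simp add: srw_step_def pmf_embed_pmf)
qed

text \<open>The law of the walk on trajectory space, obtained from its transition kernels by the
  Ionescu-Tulcea theorem.\<close>

definition srw_kernel :: "'v multigraph \<Rightarrow> 'v \<Rightarrow> nat \<Rightarrow> (nat \<Rightarrow> 'v) \<Rightarrow> 'v measure" where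
  "srw_kernel G v n x = measure_pmf (case n of 0 \<Rightarrow> return_pmf v | Suc k \<Rightarrow> srw_step G (x k))"

lemma Ionescu_Tulcea_srw: "Ionescu_Tulcea (srw_kernel G v) (\<lambda>_. count_space UNIV)"
proof (rule Ionescu_Tulcea.intro)
  fix i
  show "srw_kernel G v i \<in> Pi\<^sub>M {0..<i} (\<lambda>_. count_space UNIV) \<rightarrow>\<^sub>M subprob_algebra (count_space UNIV)"
  proof (cases i)
    case (Suc k)
    have "(\<lambda>u. measure_pmf (srw_step G u)) \<in> count_space UNIV \<rightarrow>\<^sub>M subprob_algebra (count_space UNIV)"
      by (simp add: measure_pmf_in_subprob_space)
    moreover have "(\<lambda>x. x k) \<in> Pi\<^sub>M {0..<i} (\<lambda>_. count_space UNIV) \<rightarrow>\<^sub>M count_space UNIV"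
      using Suc by (intro measurable_component_singleton) auto
    ultimately show ?thesis
      unfolding srw_kernel_def Suc by (simp add: measurable_compose)
  next
    case 0
    then have "srw_kernel G v i = (\<lambda>_. measure_pmf (return_pmf v))"
      by (simp add: srw_kernel_def fun_eq_iff)
    then show ?thesis by (simp add: measure_pmf_in_subprob_space)
  qed
next
  show "prob_space (srw_kernel G v i x)" for i x
    by (simp add: srw_kernel_def measure_pmf.prob_space_axioms)
qed

global_interpretation srw: Ionescu_Tulcea "srw_kernel G v" "\<lambda>_. count_space UNIV" for G v
  by (rule Ionescu_Tulcea_srw)

definition srw_law :: "'v multigraph \<Rightarrow> 'v \<Rightarrow> (nat \<Rightarrow> 'v) measure" where
  "srw_law G v = srw.PF.lim G v"

lemma sets_srw_law: "sets (srw_law G v) = sets (\<Pi>\<^sub>M n\<in>UNIV. count_space UNIV)"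
  unfolding srw_law_def by simp

lemma prob_space_srw_law: "prob_space (srw_law G v)"
proof (rule prob_spaceI)
  let ?S = "space (Pi\<^sub>M {} (\<lambda>_. count_space UNIV)) :: (nat \<Rightarrow> 'a) set"
  have "emeasure (srw.PF.lim G v) (srw.PF.emb UNIV {} ?S) = emeasure (srw.CI G v {}) ?S"
    by (rule srw.lim) auto
  also have "\<dots> = emeasure (srw.CI G v {}) (space (srw.CI G v {}))"
    by (simp add: srw.CI_def)
  also have "\<dots> = 1"
    by (rule prob_space.emeasure_space_1[OF srw.PF.prob_space_P]) auto
  also have "srw.PF.emb UNIV {} ?S = UNIV"
    by (auto simp: prod_emb_def space_PiM)
  finally show "emeasure (srw_law G v) (space (srw_law G v)) = 1"
    by (simp add: srw_law_def space_PiM)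
qed

lemma emeasure_srw_C:
  "emeasure (srw.C G v 0 (Suc n) (\<lambda>_. undefined)) (\<Pi>\<^sub>E i\<in>{0..<Suc n}. {w i}) =
     (if w 0 = v then \<Prod>i<n. ennreal (pmf (srw_step G (w i)) (w (Suc i))) else 0)"
proof -
  define A where "A n = (\<Pi>\<^sub>E i\<in>{0..<n}. {w i})" for n :: nat
  let ?N = "\<lambda>n. Pi\<^sub>M {0..<n} (\<lambda>_. count_space UNIV) :: (nat \<Rightarrow> 'a) measure"
  let ?C = "\<lambda>n. srw.C G v 0 n (\<lambda>_. undefined)"
  have A[measurable]: "A n \<in> sets (?N n)" for n
    unfolding A_def by (intro sets_PiM_I_finite) auto
  have C: "sets (?C n) = sets (?N n)" "space (?C n) = space (?N n)" for n
    using srw.sets_C[of "\<lambda>_. undefined" 0 G v n] srw.space_C[of "\<lambda>_. undefined" 0 G v n]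
    by (auto simp: space_PiM)
  have step: "emeasure (?C (Suc n)) (A (Suc n)) =
      emeasure (srw_kernel G v n w) {w n} * emeasure (?C n) (A n)" for n
  proof -
    have "space (?C n) \<noteq> {}" by (simp add: C space_PiM PiE_eq_empty_iff)
    moreover have "srw.eP G v n \<in> ?C n \<rightarrow>\<^sub>M subprob_algebra (?N (Suc n))"
      using srw.measurable_eP[of G v n] by (simp only: measurable_cong_sets[OF C(1) refl])
    ultimately have "emeasure (?C n \<bind> srw.eP G v n) (A (Suc n)) =
        (\<integral>\<^sup>+x. emeasure (srw.eP G v n x) (A (Suc n)) \<partial>?C n)"
      using A by (rule emeasure_bind)
    then have "emeasure (?C (Suc n)) (A (Suc n)) = (\<integral>\<^sup>+x. emeasure (srw.eP G v n x) (A (Suc n)) \<partial>?C n)"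
      by simp
    also have "\<dots> = (\<integral>\<^sup>+x. emeasure (srw_kernel G v n w) {w n} * indicator (A n) x \<partial>?C n)"
    proof (rule nn_integral_cong)
      fix x assume "x \<in> space (?C n)"
      then have x: "x \<in> space (?N n)" by (simp add: C)
      have "emeasure (srw.eP G v n x) (A (Suc n)) =
          emeasure (srw_kernel G v n x) ((\<lambda>y. x(n := y)) -` A (Suc n))"
        using srw.emeasure_eP[OF x A] by simp
      also have "(\<lambda>y. x(n := y)) -` A (Suc n) = (if x \<in> A n then {w n} else {})"
        using x by (auto simp: A_def space_PiM PiE_iff extensional_def less_Suc_eq split: if_splits)
      also have "emeasure (srw_kernel G v n x) (if x \<in> A n then {w n} else {}) =
          emeasure (srw_kernel G v n w) {w n} * indicator (A n) x"
        by (auto simp: srw_kernel_def A_def PiE_iff split: nat.split)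
      finally show "emeasure (srw.eP G v n x) (A (Suc n)) =
          emeasure (srw_kernel G v n w) {w n} * indicator (A n) x" .
    qed
    also have "\<dots> = emeasure (srw_kernel G v n w) {w n} * emeasure (?C n) (A n)"
      using A[of n] C[of n] by (simp add: nn_integral_cmult_indicator)
    finally show ?thesis .
  qed
  have "emeasure (?C 0) (A 0) = indicator (A 0) (\<lambda>_. undefined)"
    using A[of 0] by (simp only: srw.C.simps emeasure_return add_0)
  then have "emeasure (?C 0) (A 0) = 1" by (simp add: A_def)
  moreover have "emeasure (srw_kernel G v 0 w) {w 0} = (if w 0 = v then 1 else 0)"
    by (simp add: srw_kernel_def emeasure_pmf_single)
  moreover have "emeasure (srw_kernel G v (Suc k) w) {w (Suc k)} =
      ennreal (pmf (srw_step G (w k)) (w (Suc k)))" for k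
    by (simp add: srw_kernel_def emeasure_pmf_single)
  ultimately have "emeasure (?C (Suc n)) (A (Suc n)) =
     (if w 0 = v then \<Prod>i<n. ennreal (pmf (srw_step G (w i)) (w (Suc i))) else 0)"
    by (induction n) (simp_all only: step, simp_all add: mult.commute)
  then show ?thesis by (simp only: A_def)
qed

text \<open>The finite-dimensional distributions are those of the Markov chain.\<close>

lemma emeasure_srw_law:
  "emeasure (srw_law G v) {x. \<forall>i\<le>n. x i = w i} =
     (if w 0 = v then \<Prod>i<n. ennreal (pmf (srw_step G (w i)) (w (Suc i))) else 0)"
proof -
  define J where "J = {0..<Suc n}"
  let ?A = "\<Pi>\<^sub>E i\<in>J. {w i}"
  have A: "?A \<in> sets (Pi\<^sub>M J (\<lambda>_. count_space UNIV))"
    unfolding J_def by (intro sets_PiM_I_finite) auto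
  have J: "finite J" "J \<subseteq> {0..<Suc n}" by (auto simp: J_def)
  have "x \<in> srw.PF.emb UNIV J ?A \<longleftrightarrow> (\<forall>i\<in>J. x i = w i)" for x
    by (auto simp: prod_emb_def space_PiM PiE_iff)
  then have "{x. \<forall>i\<le>n. x i = w i} = srw.PF.emb UNIV J ?A"
    by (auto simp: J_def)
  then have "emeasure (srw_law G v) {x. \<forall>i\<le>n. x i = w i} = emeasure (srw.CI G v J) ?A"
    unfolding srw_law_def using srw.lim[OF J(1) A] by simp
  also have "\<dots> = emeasure (srw.C G v 0 (Suc n) (\<lambda>_. undefined)) (srw.PF.emb {0..<Suc n} J ?A)"
    by (rule srw.emeasure_CI[OF J(2) A])
  also have "srw.PF.emb {0..<Suc n} J ?A = ?A"
    unfolding J_def by (rule prod_emb_id) auto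
  finally show ?thesis unfolding J_def emeasure_srw_C .
qed

definition recurrent :: "'v multigraph \<Rightarrow> bool" where
  "recurrent G \<longleftrightarrow> (\<forall>v\<in>verts G. AE x in srw_law G v. \<exists>\<^sub>\<infinity>n. x n = v)"

definition infinite_collision_property :: "'v multigraph \<Rightarrow> bool" where
  "infinite_collision_property G \<longleftrightarrow>
     (\<forall>v\<in>verts G. AE (x, y) in srw_law G v \<Otimes>\<^sub>M srw_law G v. \<exists>\<^sub>\<infinity>n. x n = y n)"

end

theory Submission
  imports Defs
begin

text \<open>Let \<open>q(v)\<close> be the probability that two independent walks from \<open>v\<close> never meet again, and let
  \<open>u\<close> send mass \<open>deg(u) \<Sum>\<^sub>n p\<^sub>n(u,v)\<^sup>2 q(v)\<close> to \<open>v\<close>. The sum of \<open>p\<^sub>n(u,v)\<^sup>2 q(v)\<close> over \<open>n\<close> and \<open>v\<close> is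
  the probability that two walks from \<open>u\<close> have a last collision, so \<open>\<rho>\<close> sends out at most
  \<open>deg(\<rho>)\<close>, whose expectation is finite. By reversibility \<open>\<rho>\<close> receives
  \<open>deg(\<rho>) q(\<rho>) \<Sum>\<^sub>n p\<^sub>2\<^sub>n(\<rho>,\<rho>)\<close>, where the sum diverges by recurrence. So the mass received is
  almost surely finite only if \<open>q(\<rho>) = 0\<close>; it then vanishes, hence so does the mass sent out, and
  almost surely walks from \<open>\<rho>\<close> have no last collision. By connectedness \<open>q\<close> vanishes everywhere.\<close>

section \<open>Collision probabilities\<close>

text \<open>Values lie in \<open>ennreal\<close>, so sums and integrals carry no convergence side
  conditions. The recursion peels off the first step, which matches the shift identity for the law
  of trajectories proved below.\<close>

primrec trans_prob :: "'v multigraph \<Rightarrow> nat \<Rightarrow> 'v \<Rightarrow> 'v \<Rightarrow> ennreal" where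
  "trans_prob G 0 x y = (if x = y then 1 else 0)"
| "trans_prob G (Suc n) x y = (\<integral>\<^sup>+z. trans_prob G n z y \<partial>srw_step G x)"

text \<open>The probability that walks from \<open>x\<close> and \<open>y\<close> do not meet at times \<open>1, \<dots>, m\<close>; they may
  meet at time \<open>0\<close>.\<close>

primrec no_coll :: "'v multigraph \<Rightarrow> nat \<Rightarrow> 'v \<Rightarrow> 'v \<Rightarrow> ennreal" where
  "no_coll G 0 x y = 1"
| "no_coll G (Suc m) x y =
     (\<integral>\<^sup>+z. \<integral>\<^sup>+w. (if z = w then 0 else no_coll G m z w) \<partial>srw_step G y \<partial>srw_step G x)"

text \<open>The probability that walks from \<open>x\<close> and \<open>y\<close> meet at time \<open>n\<close> but not at times
  \<open>n + 1, \<dots>, n + m\<close>.\<close>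

primrec last_coll :: "'v multigraph \<Rightarrow> nat \<Rightarrow> nat \<Rightarrow> 'v \<Rightarrow> 'v \<Rightarrow> ennreal" where
  "last_coll G 0 m x y = (if x = y then no_coll G m x y else 0)"
| "last_coll G (Suc n) m x y =
     (\<integral>\<^sup>+z. \<integral>\<^sup>+w. last_coll G n m z w \<partial>srw_step G y \<partial>srw_step G x)"

text \<open>Counting measure on an uncountable type is not sigma-finite, so Fubini does not apply
  directly. Writing the pmf as a density against counting measure reduces the claim to the exchange
  of two counting integrals.\<close>

lemma nn_integral_pmf_count_space_swap:
  fixes p :: "'a pmf" and f :: "'a \<Rightarrow> 'b \<Rightarrow> ennreal"
  shows "(\<integral>\<^sup>+x. \<integral>\<^sup>+y. f x y \<partial>count_space UNIV \<partial>p) =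
      (\<integral>\<^sup>+y. \<integral>\<^sup>+x. f x y \<partial>p \<partial>count_space UNIV)"
proof -
  let ?g = "\<lambda>x y. ennreal (pmf p x) * f x y"
  have "(\<integral>\<^sup>+x. \<integral>\<^sup>+y. ?g x y \<partial>count_space UNIV \<partial>count_space UNIV) =
      (\<integral>\<^sup>+y. \<integral>\<^sup>+x. ?g x y \<partial>count_space UNIV \<partial>count_space UNIV)"
    using nn_integral_fst_count_space[of "\<lambda>(x, y). ?g x y"]
      nn_integral_snd_count_space[of "\<lambda>(x, y). ?g x y"] by simp
  then show ?thesis by (simp add: nn_integral_measure_pmf nn_integral_cmult)
qed

lemma nn_integral_count_space_point:
  "(\<integral>\<^sup>+v. (if x = v then f v else 0) \<partial>count_space UNIV) = (f x :: ennreal)"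
proof -
  have "(\<integral>\<^sup>+v. (if x = v then f v else 0) \<partial>count_space UNIV) =
      (\<integral>\<^sup>+v. f x * indicator {x} v \<partial>count_space UNIV)"
    by (intro nn_integral_cong) (auto simp: indicator_def)
  then show ?thesis by (simp add: nn_integral_cmult_indicator)
qed

section \<open>Transition probabilities: Chapman-Kolmogorov and reversibility\<close>

lemma trans_prob_le_1: "trans_prob G n x y \<le> 1"
proof (induction n arbitrary: x)
  case (Suc n)
  have "trans_prob G (Suc n) x y \<le> (\<integral>\<^sup>+z. 1 \<partial>srw_step G x)"
    unfolding trans_prob.simps by (intro nn_integral_mono Suc.IH)
  then show ?case by simp
qed simp

lemma trans_prob_1: "trans_prob G (Suc 0) x y = ennreal (pmf (srw_step G x) y)"
proof -
  have "trans_prob G (Suc 0) x y = (\<integral>\<^sup>+z. indicator {y} z \<partial>srw_step G x)"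
    unfolding trans_prob.simps by (intro nn_integral_cong) (auto simp: indicator_def)
  then show ?thesis by (simp add: emeasure_pmf_single)
qed

lemma trans_prob_add:
  "trans_prob G (n + m) x y = (\<integral>\<^sup>+z. trans_prob G n x z * trans_prob G m z y \<partial>count_space UNIV)"
proof (induction n arbitrary: x)
  case 0
  have "(\<integral>\<^sup>+z. trans_prob G 0 x z * trans_prob G m z y \<partial>count_space UNIV) =
      (\<integral>\<^sup>+z. (if x = z then trans_prob G m z y else 0) \<partial>count_space UNIV)"
    by (intro nn_integral_cong) auto
  then show ?case by (simp add: nn_integral_count_space_point)
next
  case (Suc n)
  have "trans_prob G (Suc n + m) x y =
      (\<integral>\<^sup>+u. \<integral>\<^sup>+z. trans_prob G n u z * trans_prob G m z y \<partial>count_space UNIV \<partial>srw_step G x)"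
    by (simp add: Suc.IH)
  also have "\<dots> = (\<integral>\<^sup>+z. \<integral>\<^sup>+u. trans_prob G n u z * trans_prob G m z y \<partial>srw_step G x \<partial>count_space UNIV)"
    by (rule nn_integral_pmf_count_space_swap)
  finally show ?case by (simp add: nn_integral_multc)
qed

text \<open>One-step detailed balance: the right-hand side is symmetric in \<open>u\<close> and
  \<open>v\<close>. In this product form it also covers degree 0 and vertices outside the graph,
  where both sides vanish.\<close>

lemma deg_mult_step:
  assumes "wf_multigraph G" "locally_finite G"
  shows "of_nat (deg G u) * ennreal (pmf (srw_step G u) v) = of_nat (nedges G u v)"
proof (cases "u \<in> verts G")
  case True
  then have fin: "finite {v. nedges G u v > 0}" using assms by (auto simp: locally_finite_def)
  show ?thesis
  proof (cases "deg G u = 0")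
    case True
    then have "nedges G u v = 0" using fin by (auto simp: deg_def)
    with True show ?thesis by simp
  next
    case False
    then show ?thesis
      by (simp add: pmf_srw_step[OF fin] ennreal_of_nat_eq_real_of_nat flip: ennreal_mult)
  qed
next
  case False
  then have "nedges G u w = 0" for w using assms by (auto simp: wf_multigraph_def)
  then show ?thesis by (simp add: deg_def)
qed

lemma trans_prob_reversible:
  assumes "wf_multigraph G" "locally_finite G"
  shows "of_nat (deg G u) * trans_prob G n u v = of_nat (deg G v) * trans_prob G n v u"
proof (induction n arbitrary: u v)
  case (Suc n)
  have edge: "of_nat (deg G x) * trans_prob G (Suc 0) x y =
      of_nat (deg G y) * trans_prob G (Suc 0) y x" for x y
    using assms by (simp only: trans_prob_1 deg_mult_step) (simp add: wf_multigraph_def)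
  have "of_nat (deg G u) * trans_prob G (Suc n) u v =
     (\<integral>\<^sup>+w. of_nat (deg G u) * (trans_prob G (Suc 0) u w * trans_prob G n w v) \<partial>count_space UNIV)"
    using trans_prob_add[of G "Suc 0" n u v] by (simp add: nn_integral_cmult del: trans_prob.simps)
  also have "\<dots> = (\<integral>\<^sup>+w. of_nat (deg G v) * (trans_prob G n v w * trans_prob G (Suc 0) w u) \<partial>count_space UNIV)"
  proof (intro nn_integral_cong)
    fix w
    \<comment> \<open>The left side splits off the first step, the right side the last one. One-step
      balance moves the degree from \<open>u\<close> to \<open>w\<close>, and the induction
      hypothesis moves it from \<open>w\<close> to \<open>v\<close>.\<close>
    have "of_nat (deg G u) * (trans_prob G (Suc 0) u w * trans_prob G n w v) =
        trans_prob G (Suc 0) w u * (of_nat (deg G w) * trans_prob G n w v)"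
      by (metis (no_types, opaque_lifting) edge mult.assoc mult.commute)
    also have "\<dots> = of_nat (deg G v) * (trans_prob G n v w * trans_prob G (Suc 0) w u)"
      unfolding Suc.IH[of w v] by (simp add: ac_simps del: trans_prob.simps)
    finally show "of_nat (deg G u) * (trans_prob G (Suc 0) u w * trans_prob G n w v) = 
      of_nat (deg G v) * (trans_prob G n v w * trans_prob G (Suc 0) w u)" .
  qed
  also have "\<dots> = of_nat (deg G v) * trans_prob G (Suc n) v u"
    using trans_prob_add[of G n "Suc 0" v u] by (simp add: nn_integral_cmult del: trans_prob.simps)
  finally show ?case .
qed simp

section \<open>Decomposition at the last collision\<close>

lemma last_coll_eq:
  "last_coll G n m x y =
     (\<integral>\<^sup>+v. trans_prob G n x v * trans_prob G n y v * no_coll G m v v \<partial>count_space UNIV)"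
proof (induction n arbitrary: x y)
  case 0
  have "(\<integral>\<^sup>+v. trans_prob G 0 x v * trans_prob G 0 y v * no_coll G m v v \<partial>count_space UNIV) =
      (\<integral>\<^sup>+v. (if x = v then if y = v then no_coll G m v v else 0 else 0) \<partial>count_space UNIV)"
    by (intro nn_integral_cong) auto
  then show ?case by (auto simp: nn_integral_count_space_point)
next
  case (Suc n)
  have "last_coll G (Suc n) m x y = (\<integral>\<^sup>+z. \<integral>\<^sup>+w. \<integral>\<^sup>+v. trans_prob G n z v * trans_prob G n w v *
      no_coll G m v v \<partial>count_space UNIV \<partial>srw_step G y \<partial>srw_step G x)"
    by (simp add: Suc.IH)
  \<comment> \<open>The sum over the collision point \<open>v\<close> passes outside both first-step
    integrals. These then factor, since for fixed \<open>v\<close> the integrand is a product of a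
    function of \<open>z\<close> and one of \<open>w\<close>.\<close>
  also have "\<dots> = (\<integral>\<^sup>+v. \<integral>\<^sup>+z. \<integral>\<^sup>+w. trans_prob G n z v * trans_prob G n w v *
      no_coll G m v v \<partial>srw_step G y \<partial>srw_step G x \<partial>count_space UNIV)"
    by (simp only: nn_integral_pmf_count_space_swap)
  finally show ?case by (simp add: nn_integral_cmult nn_integral_multc)
qed

text \<open>Up to time \<open>N\<close> there is either exactly one last collision or none at all.\<close>

lemma sum_last_coll:
  "(\<Sum>n\<le>N. last_coll G n (N - n) x y) + (if x = y then 0 else no_coll G N x y) = 1"
proof (induction N arbitrary: x y)
  case (Suc N)
  \<comment> \<open>No case distinction on \<open>x = y\<close> here: the summand for time 0 is
    \<open>no_coll G (Suc N) x y\<close> exactly when \<open>x = y\<close>, and the extra term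
    supplies it otherwise.\<close>
  have "(\<Sum>n\<le>N. last_coll G (Suc n) (N - n) x y) + no_coll G (Suc N) x y =
     (\<integral>\<^sup>+z. \<integral>\<^sup>+w. (\<Sum>n\<le>N. last_coll G n (N - n) z w) + (if z = w then 0 else no_coll G N z w)
        \<partial>srw_step G y \<partial>srw_step G x)"
    by (simp add: nn_integral_add nn_integral_sum del: sum.atMost_Suc)
  also have "\<dots> = 1" by (simp only: Suc.IH) simp
  finally show ?case
    unfolding sum.atMost_Suc_shift by (auto simp: ac_simps simp del: no_coll.simps last_coll.simps(2))
qed simp

lemma no_coll_antimono: "no_coll G (Suc m) x y \<le> no_coll G m x y"
proof (induction m arbitrary: x y)
  case 0
  have "no_coll G (Suc 0) x y \<le> (\<integral>\<^sup>+z. \<integral>\<^sup>+w. 1 \<partial>srw_step G y \<partial>srw_step G x)"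
    unfolding no_coll.simps by (intro nn_integral_mono) auto
  then show ?case by simp
next
  case (Suc m)
  show ?case
    by (subst (1 2) no_coll.simps(2)) (intro nn_integral_mono, use Suc.IH in auto)
qed

text \<open>Thus the infimum over \<open>m\<close> is a limit, and
  \<open>INF m. no_coll G m v v\<close> is the probability q(v) that two walks from \<open>v\<close>
  never meet again.\<close>

lemma decseq_no_coll: "decseq (\<lambda>m. no_coll G m x y)"
  using no_coll_antimono by (rule decseq_SucI)

lemma last_coll_le_1: "last_coll G n m x y \<le> 1"
proof -
  have "last_coll G n ((n + m) - n) x y \<le> (\<Sum>k\<le>n+m. last_coll G k (n + m - k) x y)"
    by (rule member_le_sum) auto
  also have "\<dots> \<le> 1"
    using sum_last_coll[where N="n+m" and G=G and x=x and y=y] by (metis le_iff_add)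
  finally show ?thesis by simp
qed

text \<open>Finiteness of \<open>c\<close> matters: for infinite \<open>c\<close> and a positive
  sequence decreasing to 0, the left side is infinite and the right side is 0.\<close>

lemma INF_cmult_ennreal:
  fixes c :: ennreal
  assumes "decseq f" "c < \<top>"
  shows "(INF m. c * f m) = c * (INF m. f m)"
proof -
  have "decseq (\<lambda>m. c * f m)"
    using assms(1) by (auto simp: decseq_def intro: mult_left_mono)
  then have "(\<lambda>m. c * f m) \<longlonglongrightarrow> (INF m. c * f m)" by (rule LIMSEQ_INF)
  moreover have "(\<lambda>m. c * f m) \<longlonglongrightarrow> c * (INF m. f m)"
    using assms(2) LIMSEQ_INF[OF assms(1)] by (rule ennreal_tendsto_cmult)
  ultimately show ?thesis by (rule LIMSEQ_unique)
qed

text \<open>Monotone convergence from above, applicable because the integral at \<open>m = 0\<close>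
  is at most 1.\<close>

lemma INF_last_coll:
  "(INF m. last_coll G n m x y) =
     (\<integral>\<^sup>+v. trans_prob G n x v * trans_prob G n y v * (INF m. no_coll G m v v) \<partial>count_space UNIV)"
proof -
  have "(INF m. last_coll G n m x y) = (\<integral>\<^sup>+v. (INF m. trans_prob G n x v * trans_prob G n y v * no_coll G m v v) \<partial>count_space UNIV)"
    unfolding last_coll_eq
  proof (rule nn_integral_monotone_convergence_INF_decseq[symmetric])
    show "decseq (\<lambda>m v. trans_prob G n x v * trans_prob G n y v * no_coll G m v v)"
      by (intro decseq_SucI le_funI mult_left_mono no_coll_antimono) simp
    show "(\<integral>\<^sup>+v. trans_prob G n x v * trans_prob G n y v * no_coll G 0 v v \<partial>count_space UNIV) < \<infinity>"
      unfolding last_coll_eq[symmetric] using last_coll_le_1[of G n 0 x y] by (auto simp: less_top[symmetric] top_unique)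
  qed simp
  also have "\<dots> = (\<integral>\<^sup>+v. trans_prob G n x v * trans_prob G n y v * (INF m. no_coll G m v v) \<partial>count_space UNIV)"
  proof (intro nn_integral_cong)
    fix v
    have "trans_prob G n x v * trans_prob G n y v < \<top>"
      using trans_prob_le_1[of G n x v] trans_prob_le_1[of G n y v]
      by (auto simp: less_top[symmetric] ennreal_mult_eq_top_iff top_unique)
    then show "(INF m. trans_prob G n x v * trans_prob G n y v * no_coll G m v v) =
        trans_prob G n x v * trans_prob G n y v * (INF m. no_coll G m v v)"
      by (rule INF_cmult_ennreal[OF decseq_no_coll])
  qed
  finally show ?thesis .
qed

lemma suminf_INF_last_coll_le_1: "(\<Sum>n. INF m. last_coll G n m x y) \<le> 1"
proof -
  have "(\<Sum>n<N. INF m. last_coll G n m x y) \<le> 1" for N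
  proof -
    \<comment> \<open>Each infimum is bounded by its value at \<open>m = N - n\<close>, so that all
      terms refer to the same horizon \<open>N\<close> and the partition identity applies.\<close>
    have "(\<Sum>n<N. INF m. last_coll G n m x y) \<le> (\<Sum>n\<le>N. last_coll G n (N - n) x y)"
      by (intro order_trans[OF sum_mono sum_mono2]) (auto intro: INF_lower)
    also have "\<dots> \<le> 1" using sum_last_coll[where N=N and G=G and x=x and y=y] by (metis le_iff_add)
    finally show ?thesis .
  qed
  then show ?thesis by (auto simp: suminf_eq_SUP intro: SUP_least)
qed

section \<open>The law of two independent walks\<close>

abbreviation traj_space :: "(nat \<Rightarrow> 'v) measure" where
  "traj_space \<equiv> \<Pi>\<^sub>M n\<in>UNIV. count_space UNIV"

lemma space_srw_law [simp]: "space (srw_law G v) = UNIV"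
  using sets_eq_imp_space_eq[OF sets_srw_law[of G v]] by (simp add: space_PiM)

definition cylinder :: "(nat \<Rightarrow> 'v) \<Rightarrow> nat \<Rightarrow> (nat \<Rightarrow> 'v) set" where
  "cylinder w n = {x. \<forall>i\<le>n. x i = w i}"

lemma cylinder_measurable: "cylinder w n \<in> sets traj_space"
proof -
  have "cylinder w n = {x\<in>space traj_space. \<forall>i\<in>{..n}. x i = w i}"
    by (auto simp: cylinder_def space_PiM)
  also have "\<dots> \<in> sets traj_space"
  proof (rule sets.sets_Collect_finite_All)
    fix i assume "i \<in> {..n}"
    have "(\<lambda>x. x i) -` {w i} \<inter> space traj_space \<in>
        sets (traj_space :: (nat \<Rightarrow> 'a) measure)"
      by (rule measurable_sets[OF measurable_component_singleton]) auto
    then show "{x \<in> space traj_space. x i = w i} \<in> sets traj_space"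
      by (simp add: vimage_def Collect_conj_eq Int_commute)
  qed auto
  finally show ?thesis .
qed

text \<open>Cylinders form a tree: any two are nested or disjoint. With the empty set added they are
  stable under intersection.\<close>

lemma cylinder_Int:
  "n \<le> m \<Longrightarrow> cylinder v n \<inter> cylinder w m = (if w \<in> cylinder v n then cylinder w m else {})"
  by (auto simp: cylinder_def)

lemma sets_traj_space_cylinder:
  "sets (traj_space :: (nat \<Rightarrow> 'v::countable) measure) =
     sigma_sets UNIV (insert {} {cylinder w n | w n. True})" (is "_ = sigma_sets UNIV ?E")
proof
  show "sigma_sets UNIV ?E \<subseteq> sets (traj_space :: (nat \<Rightarrow> 'v) measure)"
    using sets.sigma_sets_subset[of ?E traj_space] cylinder_measurable by (auto simp: space_PiM)
  interpret sigma_algebra UNIV "sigma_sets UNIV ?E" by (rule sigma_algebra_sigma_sets) auto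
  have "{x. x i = a} \<in> sigma_sets UNIV ?E" for i :: nat and a :: 'v
  proof -
    \<comment> \<open>The list \<open>l\<close> runs over the countably many possible values at
      times below \<open>i\<close>. Entries of \<open>l @ [a]\<close> beyond index \<open>i\<close>
      are never read by this cylinder.\<close>
    have "{x. x i = a} = (\<Union>l\<in>{l. length l = i}. cylinder (\<lambda>k. (l @ [a]) ! k) i)"
    proof (intro set_eqI iffI)
      fix x :: "nat \<Rightarrow> 'v" assume "x \<in> {x. x i = a}"
      then have "x \<in> cylinder (\<lambda>k. (map x [0..<i] @ [a]) ! k) i"
        by (auto simp: cylinder_def nth_append not_less)
      then show "x \<in> (\<Union>l\<in>{l. length l = i}. cylinder (\<lambda>k. (l @ [a]) ! k) i)" by force
    qed (auto simp: cylinder_def)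
    also have "\<dots> \<in> sigma_sets UNIV ?E"
      by (rule countable_UN) (auto intro: sigma_sets.Basic)
    finally show ?thesis .
  qed
  note coord = this
  have "(\<lambda>x. x i) -` A \<in> sigma_sets UNIV ?E" for i :: nat and A :: "'v set"
  proof -
    have "(\<lambda>x. x i) -` A = (\<Union>a\<in>A. {x. x i = a})" by auto
    also have "\<dots> \<in> sigma_sets UNIV ?E" by (rule countable_UN) (use coord in auto)
    finally show ?thesis .
  qed
  then show "sets (traj_space :: (nat \<Rightarrow> 'v) measure) \<subseteq> sigma_sets UNIV ?E"
    by (auto simp: sets_PiM_single intro!: sigma_sets_mono)
       (auto simp: vimage_def)
qed

section \<open>The Markov property at time one\<close>

lemma measurable_case_nat_traj: "case_nat v \<in> traj_space \<rightarrow>\<^sub>M traj_space"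
proof (rule measurable_PiM_single')
  fix i :: nat
  show "(\<lambda>x. case_nat v x i) \<in> traj_space \<rightarrow>\<^sub>M count_space UNIV"
    by (cases i) auto
qed (auto simp: space_PiM)

lemma emeasure_srw_law_cylinder:
  "emeasure (srw_law G v) (cylinder w n) =
     (if w 0 = v then \<Prod>i<n. ennreal (pmf (srw_step G (w i)) (w (Suc i))) else 0)"
  unfolding cylinder_def by (rule emeasure_srw_law)

text \<open>The map \<open>case_nat v\<close> prepends the starting point to a trajectory: take one
  step, run a fresh walk from there and prepend \<open>v\<close>. Both sides agree on cylinders, an
  intersection-stable generator.\<close>

lemma srw_law_bind:
  fixes G :: "'v::countable multigraph"
  shows "srw_law G v = measure_pmf (srw_step G v) \<bind> (\<lambda>w. distr (srw_law G w) traj_space (case_nat v))"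
proof (rule measure_eqI_generator_eq_countable)
  let ?p = "measure_pmf (srw_step G v)"
  let ?N = "\<lambda>w. distr (srw_law G w) traj_space (case_nat v)"
  let ?E = "insert {} {cylinder w n | (w :: nat \<Rightarrow> 'v) n. True}"
  have case_nat: "case_nat v \<in> srw_law G w \<rightarrow>\<^sub>M traj_space" for w
    using measurable_case_nat_traj by (simp cong: measurable_cong_sets add: sets_srw_law)
  have N: "?N \<in> ?p \<rightarrow>\<^sub>M subprob_algebra traj_space"
  proof -
    have "?N w \<in> space (subprob_algebra traj_space)" for w
      using prob_space.prob_space_distr[OF prob_space_srw_law case_nat]
      by (auto simp: space_subprob_algebra intro: prob_space_imp_subprob_space)
    then show ?thesis by auto
  qed
  show "Int_stable ?E"
  proof (rule Int_stableI)
    fix A B assume "A \<in> ?E" "B \<in> ?E"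
    moreover have "cylinder u n \<inter> cylinder w m \<in> ?E" for u w :: "nat \<Rightarrow> 'v" and n m
    proof (cases "n \<le> m")
      case True
      then show ?thesis using cylinder_Int[of n m u w] by auto
    next
      case False
      then show ?thesis using cylinder_Int[of m n w u] by (auto simp: Int_commute)
    qed
    ultimately show "A \<inter> B \<in> ?E" by (elim insertE CollectE exE) (simp_all only: Int_empty_left Int_empty_right insertI1)
  qed
  show "sets (srw_law G v) = sigma_sets UNIV ?E"
    by (simp add: sets_srw_law sets_traj_space_cylinder)
  show "sets (?p \<bind> ?N) = sigma_sets UNIV ?E"
    by (subst sets_bind[OF sets_kernel[OF N]]) (auto simp: sets_traj_space_cylinder)
  fix A assume "A \<in> ?E"
  then consider "A = {}" | w n where "A = cylinder w n" by auto
  then show "emeasure (srw_law G v) A = emeasure (?p \<bind> ?N) A"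
  proof cases
    case (2 w n)
    \<comment> \<open>Removing the prepended point leaves a cylinder over the shifted
      \<open>w\<close> with one coordinate fewer, which for \<open>n = 0\<close> imposes no
      condition at all.\<close>
    have vimage: "emeasure (?N u) (cylinder w n) =
        (if w 0 = v then (case n of 0 \<Rightarrow> 1 | Suc k \<Rightarrow> indicator {w (Suc 0)} u *
            (\<Prod>i<k. ennreal (pmf (srw_step G (w (Suc i))) (w (Suc (Suc i)))))) else 0)" for u
    proof -
      have "emeasure (?N u) (cylinder w n) = emeasure (srw_law G u) (case_nat v -` cylinder w n)"
        using emeasure_distr[OF case_nat cylinder_measurable] by simp
      also have "case_nat v -` cylinder w n =
          (if w 0 = v then (case n of 0 \<Rightarrow> UNIV | Suc k \<Rightarrow> cylinder (\<lambda>i. w (Suc i)) k) else {})"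
        by (auto simp: cylinder_def split: nat.splits)
      finally show ?thesis
        using prob_space.emeasure_space_1[OF prob_space_srw_law[of G u]]
        by (auto simp: emeasure_srw_law_cylinder split: nat.split)
    qed
    have "emeasure (?p \<bind> ?N) (cylinder w n) =
        (\<integral>\<^sup>+u. emeasure (?N u) (cylinder w n) \<partial>?p)"
      by (rule emeasure_bind[OF _ N cylinder_measurable]) simp
    also have "\<dots> =
        (if w 0 = v then \<Prod>i<n. ennreal (pmf (srw_step G (w i)) (w (Suc i))) else 0)"
      unfolding vimage
      by (cases n) (simp_all add: nn_integral_multc emeasure_pmf_single prod.lessThan_Suc_shift
          del: prod.lessThan_Suc)
    finally show ?thesis by (simp add: 2 emeasure_srw_law_cylinder)
  qed simp
next
  let ?A = "range (\<lambda>a. cylinder (\<lambda>_. a) 0) :: (nat \<Rightarrow> 'v) set set"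
  show "?A \<subseteq> insert {} {cylinder w n | w n. True}" by auto
  show "\<Union>?A = UNIV" by (auto simp: cylinder_def)
  show "countable ?A" by auto
  show "emeasure (srw_law G v) a \<noteq> \<infinity>" for a
    using prob_space.emeasure_le_1[OF prob_space_srw_law] by (metis ennreal_one_less_top infinity_ennreal_def leD)
qed auto

lemma nn_integral_srw_law:
  fixes G :: "'v::countable multigraph"
  assumes "f \<in> borel_measurable traj_space"
  shows "(\<integral>\<^sup>+x. f x \<partial>srw_law G v) =
      (\<integral>\<^sup>+w. \<integral>\<^sup>+x. f (case_nat v x) \<partial>srw_law G w \<partial>srw_step G v)"
proof -
  have case_nat: "case_nat v \<in> srw_law G w \<rightarrow>\<^sub>M traj_space" for w
    using measurable_case_nat_traj by (simp cong: measurable_cong_sets add: sets_srw_law)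
  have "distr (srw_law G w) traj_space (case_nat v) \<in> space (subprob_algebra traj_space)" for w
    using prob_space.prob_space_distr[OF prob_space_srw_law case_nat]
    by (auto simp: space_subprob_algebra intro: prob_space_imp_subprob_space)
  then have "(\<lambda>w. distr (srw_law G w) traj_space (case_nat v)) \<in>
      measure_pmf (srw_step G v) \<rightarrow>\<^sub>M subprob_algebra traj_space" by auto
  then show ?thesis
    by (subst srw_law_bind) (simp add: nn_integral_bind[OF assms] nn_integral_distr[OF case_nat] assms)
qed

lemma emeasure_srw_law_shift:
  fixes G :: "'v::countable multigraph"
  assumes "A \<in> sets traj_space"
  shows "emeasure (srw_law G v) A =
      (\<integral>\<^sup>+w. emeasure (srw_law G w) (case_nat v -` A) \<partial>srw_step G v)"
proof -
  have "emeasure (srw_law G v) A = (\<integral>\<^sup>+x. indicator A x \<partial>srw_law G v)"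
    using assms by (simp add: sets_srw_law)
  also have "\<dots> = (\<integral>\<^sup>+w. \<integral>\<^sup>+x. indicator A (case_nat v x) \<partial>srw_law G w \<partial>srw_step G v)"
    using assms by (intro nn_integral_srw_law) simp
  also have "\<dots> = (\<integral>\<^sup>+w. \<integral>\<^sup>+x. indicator (case_nat v -` A) x \<partial>srw_law G w \<partial>srw_step G v)"
    by (intro nn_integral_cong) (auto simp: indicator_def)
  also have "\<dots> = (\<integral>\<^sup>+w. emeasure (srw_law G w) (case_nat v -` A) \<partial>srw_step G v)"
    using measurable_sets[OF measurable_case_nat_traj assms, of v]
    by (simp add: sets_srw_law space_PiM)
  finally show ?thesis .
qed

section \<open>Pairs of independent walks\<close>

abbreviation pair_law :: "'v multigraph \<Rightarrow> 'v \<Rightarrow> 'v \<Rightarrow> ((nat \<Rightarrow> 'v) \<times> (nat \<Rightarrow> 'v)) measure" where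
  "pair_law G u v \<equiv> srw_law G u \<Otimes>\<^sub>M srw_law G v"

lemma sets_pair_law: "sets (pair_law G u v) = sets (traj_space \<Otimes>\<^sub>M traj_space)"
  by (intro sets_pair_measure_cong sets_srw_law)

lemma pair_case_nat_vimage_sets:
  assumes "A \<in> sets (traj_space \<Otimes>\<^sub>M traj_space)"
  shows "{(x, y). (case_nat u x, y) \<in> A} \<in> sets (traj_space \<Otimes>\<^sub>M traj_space)"
    and "{(x, y). (x, case_nat u y) \<in> A} \<in> sets (traj_space \<Otimes>\<^sub>M traj_space)"
proof -
  have "(\<lambda>z. (case_nat u (fst z), snd z)) \<in>
      traj_space \<Otimes>\<^sub>M traj_space \<rightarrow>\<^sub>M traj_space \<Otimes>\<^sub>M traj_space"
    and "(\<lambda>z. (fst z, case_nat u (snd z))) \<in> traj_space \<Otimes>\<^sub>M traj_space \<rightarrow>\<^sub>M traj_space \<Otimes>\<^sub>M traj_space"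
    by (intro measurable_Pair measurable_compose[OF _ measurable_case_nat_traj] measurable_fst measurable_snd)+
  from this[THEN measurable_sets, OF assms]
  show "{(x, y). (case_nat u x, y) \<in> A} \<in> sets (traj_space \<Otimes>\<^sub>M traj_space)"
    and "{(x, y). (x, case_nat u y) \<in> A} \<in> sets (traj_space \<Otimes>\<^sub>M traj_space)"
    by (simp_all add: space_pair_measure space_PiM vimage_def case_prod_unfold)
qed

text \<open>The walks take their first steps one after the other: slicing the event along either
  factor reduces the claim to the shift identity for a single walk. The result is the recursion
  shared by \<open>no_coll\<close> and \<open>last_coll\<close>.\<close>

lemma emeasure_pair_law_shift:
  fixes G :: "'v::countable multigraph"
  assumes A: "A \<in> sets (traj_space \<Otimes>\<^sub>M traj_space)"
  shows "emeasure (pair_law G u v) A =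
     (\<integral>\<^sup>+z. \<integral>\<^sup>+w. emeasure (pair_law G z w) {(x, y). (case_nat u x, case_nat v y) \<in> A}
        \<partial>srw_step G v \<partial>srw_step G u)"
proof -
  have law: "prob_space (srw_law G z)" for z by (rule prob_space_srw_law)
  have sf: "sigma_finite_measure (srw_law G z)" for z
    using law prob_space_imp_sigma_finite by blast
  have psf: "pair_sigma_finite (srw_law G z) (srw_law G w)" for z w
    using sf by (simp add: pair_sigma_finite_def)
  have fst_step: "emeasure (pair_law G u v) A =
      (\<integral>\<^sup>+z. emeasure (pair_law G z v) {(x, y). (case_nat u x, y) \<in> A} \<partial>srw_step G u)"
  proof -
    have sets: "A \<in> sets (pair_law G z v)"
      "{(x, y). (case_nat u x, y) \<in> A} \<in> sets (pair_law G z v)" for z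
      using A pair_case_nat_vimage_sets(1)[OF A] by (simp_all add: sets_pair_law)
    have "emeasure (pair_law G u v) A =
        (\<integral>\<^sup>+x. emeasure (srw_law G v) (Pair x -` A) \<partial>srw_law G u)"
      by (rule sigma_finite_measure.emeasure_pair_measure_alt[OF sf sets(1)])
    also have "\<dots> = (\<integral>\<^sup>+z. \<integral>\<^sup>+x. emeasure (srw_law G v) (Pair (case_nat u x) -` A) \<partial>srw_law G z \<partial>srw_step G u)"
      using sigma_finite_measure.measurable_emeasure_Pair[OF sf sets(1)]
      by (intro nn_integral_srw_law) (simp cong: measurable_cong_sets add: sets_srw_law)
    also have "\<dots> =
        (\<integral>\<^sup>+z. emeasure (pair_law G z v) {(x, y). (case_nat u x, y) \<in> A} \<partial>srw_step G u)"
      by (subst sigma_finite_measure.emeasure_pair_measure_alt[OF sf sets(2)]) (simp add: vimage_def)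
    finally show ?thesis .
  qed
  have snd_step: "emeasure (pair_law G z v) B =
      (\<integral>\<^sup>+w. emeasure (pair_law G z w) {(x, y). (x, case_nat v y) \<in> B} \<partial>srw_step G v)"
    if B: "B \<in> sets (traj_space \<Otimes>\<^sub>M traj_space)" for B :: "((nat \<Rightarrow> 'v) \<times> (nat \<Rightarrow> 'v)) set" and z
  proof -
    have sets: "B \<in> sets (pair_law G z w)"
      "{(x, y). (x, case_nat v y) \<in> B} \<in> sets (pair_law G z w)" for w
      using B pair_case_nat_vimage_sets(2)[OF B] by (simp_all add: sets_pair_law)
    have "emeasure (pair_law G z v) B =
        (\<integral>\<^sup>+y. emeasure (srw_law G z) ((\<lambda>x. (x, y)) -` B) \<partial>srw_law G v)"
      by (rule pair_sigma_finite.emeasure_pair_measure_alt2[OF psf sets(1)])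
    also have "\<dots> = (\<integral>\<^sup>+w. \<integral>\<^sup>+y. emeasure (srw_law G z) ((\<lambda>x. (x, case_nat v y)) -` B) \<partial>srw_law G w \<partial>srw_step G v)"
      using pair_sigma_finite.measurable_emeasure_Pair2[OF psf sets(1)]
      by (intro nn_integral_srw_law) (simp cong: measurable_cong_sets add: sets_srw_law)
    also have "\<dots> =
        (\<integral>\<^sup>+w. emeasure (pair_law G z w) {(x, y). (x, case_nat v y) \<in> B} \<partial>srw_step G v)"
      by (subst pair_sigma_finite.emeasure_pair_measure_alt2[OF psf sets(2)]) (simp add: vimage_def)
    finally show ?thesis .
  qed
  show ?thesis by (subst fst_step) (simp add: snd_step[OF pair_case_nat_vimage_sets(1)[OF A]])
qed

lemma traj_eq_sets:
  shows "{x. x n = w} \<in> sets (traj_space :: (nat \<Rightarrow> 'v) measure)"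
proof -
  have "(\<lambda>x. x n) -` {w} \<inter> space traj_space \<in>
      sets (traj_space :: (nat \<Rightarrow> 'v) measure)"
    by (rule measurable_sets[OF measurable_component_singleton]) auto
  then show ?thesis by (simp add: vimage_def space_PiM)
qed

text \<open>Countability of the vertex type makes the diagonal a countable union of measurable
  rectangles.\<close>

lemma pair_traj_eq_sets:
  "{(x, y). x n = (y n :: 'v::countable)} \<in> sets (traj_space \<Otimes>\<^sub>M traj_space)"
proof -
  have "{(x, y). x n = (y n :: 'v)} = (\<Union>w\<in>UNIV. {x. x n = w} \<times> {y. y n = w})" by auto
  also have "\<dots> \<in> sets (traj_space \<Otimes>\<^sub>M traj_space)"
    by (intro sets.countable_UN') (auto intro: pair_measureI traj_eq_sets)
  finally show ?thesis .
qed

section \<open>Meeting events and their probabilities\<close>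

definition avoid_set :: "nat \<Rightarrow> ((nat \<Rightarrow> 'v) \<times> (nat \<Rightarrow> 'v)) set" where
  "avoid_set m = {(x, y). \<forall>k<m. x k \<noteq> y k}"

definition last_meet_set :: "nat \<Rightarrow> nat \<Rightarrow> ((nat \<Rightarrow> 'v) \<times> (nat \<Rightarrow> 'v)) set" where
  "last_meet_set n m = {(x, y). x n = y n \<and> (\<forall>k<m. x (n + Suc k) \<noteq> y (n + Suc k))}"

lemma avoid_set_sets: "avoid_set m \<in> sets (traj_space \<Otimes>\<^sub>M (traj_space :: (nat \<Rightarrow> 'v::countable) measure))"
proof (induction m)
  case 0
  have "avoid_set 0 = space (traj_space \<Otimes>\<^sub>M (traj_space :: (nat \<Rightarrow> 'v::countable) measure))"
    by (auto simp: avoid_set_def space_pair_measure space_PiM)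
  then show ?case by (simp only: sets.top)
next
  case (Suc m)
  have "avoid_set (Suc m) = avoid_set m - {(x, y). x m = (y m :: 'v)}"
    by (auto simp: avoid_set_def less_Suc_eq)
  then show ?case using Suc pair_traj_eq_sets by auto
qed

lemma last_meet_set_sets:
  "last_meet_set n m \<in> sets (traj_space \<Otimes>\<^sub>M (traj_space :: (nat \<Rightarrow> 'v::countable) measure))"
proof (induction m)
  case 0
  then show ?case using pair_traj_eq_sets by (simp add: last_meet_set_def)
next
  case (Suc m)
  have "last_meet_set n (Suc m) =
      last_meet_set n m - {(x, y). x (n + Suc m) = (y (n + Suc m) :: 'v)}"
    by (auto simp: last_meet_set_def less_Suc_eq)
  then show ?case using Suc pair_traj_eq_sets by (metis sets.Diff)
qed

lemma emeasure_pair_law_UNIV: "emeasure (pair_law G u v) UNIV = 1"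
proof -
  interpret u: prob_space "srw_law G u" by (rule prob_space_srw_law)
  interpret v: prob_space "srw_law G v" by (rule prob_space_srw_law)
  interpret pair_prob_space "srw_law G u" "srw_law G v" ..
  show ?thesis using P.emeasure_space_1 by (simp add: space_pair_measure)
qed

text \<open>The event counts time 0, whereas \<open>no_coll\<close> starts at time 1. This explains
  both the index shift and the value 0 for equal starting points.\<close>

lemma emeasure_avoid_set:
  fixes G :: "'v::countable multigraph"
  shows "emeasure (pair_law G u v) (avoid_set (Suc m)) = (if u = v then 0 else no_coll G m u v)"
proof (induction m arbitrary: u v)
  have shift: "{(x, y). (case_nat u x, case_nat v y) \<in> avoid_set (Suc m)} =
      (if u = v then {} else avoid_set m)" for u v :: 'v and m
    by (auto simp: avoid_set_def less_Suc_eq_0_disj)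
  {
    case 0
    show ?case
      by (subst emeasure_pair_law_shift[OF avoid_set_sets], unfold shift)
        (simp add: avoid_set_def emeasure_pair_law_UNIV)
  next
    case (Suc m)
    show ?case
      by (subst emeasure_pair_law_shift[OF avoid_set_sets], unfold shift) (simp add: Suc.IH)
  }
qed

lemma emeasure_last_meet_set:
  fixes G :: "'v::countable multigraph"
  shows "emeasure (pair_law G u v) (last_meet_set n m) = last_coll G n m u v"
proof (induction n arbitrary: u v)
  case 0
  have shift: "{(x, y). (case_nat u x, case_nat v y) \<in> last_meet_set 0 m} =
      (if u = v then avoid_set m else {})"
    by (auto simp: avoid_set_def last_meet_set_def)
  show ?case
    by (subst emeasure_pair_law_shift[OF last_meet_set_sets], unfold shift, cases m)
      (simp_all add: emeasure_avoid_set avoid_set_def[of 0] emeasure_pair_law_UNIV)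
next
  case (Suc n)
  have shift: "{(x, y). (case_nat u x, case_nat v y) \<in> last_meet_set (Suc n) m} =
      last_meet_set n m"
    by (auto simp: last_meet_set_def)
  show ?case
    by (subst emeasure_pair_law_shift[OF last_meet_set_sets], unfold shift) (simp add: Suc.IH)
qed

section \<open>Returns, recurrence and infinitely many collisions\<close>

lemma emeasure_srw_law_at:
  fixes G :: "'v::countable multigraph"
  shows "emeasure (srw_law G u) {x. x n = v} = trans_prob G n u v"
proof (induction n arbitrary: u)
  case 0
  have "case_nat u -` {x. x 0 = v} = (if u = v then UNIV else {})" by auto
  then show ?case
    using prob_space.emeasure_space_1[OF prob_space_srw_law, of G]
    by (subst emeasure_srw_law_shift[OF traj_eq_sets]) simp
next
  case (Suc n)
  have "case_nat u -` {x. x (Suc n) = v} = {x. x n = v}" by auto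
  then show ?case by (subst emeasure_srw_law_shift[OF traj_eq_sets]) (simp add: Suc.IH)
qed

text \<open>By Borel-Cantelli, a finite expected number of visits would almost surely leave only
  finitely many visits.\<close>

lemma suminf_trans_prob_recurrent:
  fixes G :: "'v::countable multigraph"
  assumes "recurrent G" "v \<in> verts G"
  shows "(\<Sum>n. trans_prob G n v v) = \<infinity>"
proof (rule ccontr)
  assume fin: "(\<Sum>n. trans_prob G n v v) \<noteq> \<infinity>"
  interpret prob_space "srw_law G v" by (rule prob_space_srw_law)
  let ?A = "\<lambda>n. {x. x n = v}"
  have "(\<Sum>n. ennreal (prob (?A n))) \<noteq> \<top>"
    using fin by (simp add: emeasure_srw_law_at flip: emeasure_eq_measure)
  then have "summable (\<lambda>n. prob (?A n))"
    by (intro summable_suminf_not_top) auto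
  then have "AE x in srw_law G v. eventually (\<lambda>n. x \<in> space (srw_law G v) - ?A n) sequentially"
    by (intro borel_cantelli_AE1) (auto simp: sets_srw_law traj_eq_sets emeasure_eq_measure)
  moreover have "AE x in srw_law G v. \<exists>\<^sub>\<infinity>n. x n = v"
    using assms by (auto simp: recurrent_def)
  ultimately have "AE x in srw_law G v. False"
    by eventually_elim (auto simp: frequently_def cofinite_eq_sequentially)
  then show False by simp
qed

text \<open>The walks meet at time 0, and almost surely none of the countably many times is that of
  a last collision. Hence every collision is followed by another.\<close>

lemma infinite_collision_propertyI:
  fixes G :: "'v::countable multigraph"
  assumes last: "\<And>v n. v \<in> verts G \<Longrightarrow> (INF m. last_coll G n m v v) = 0"
  shows "infinite_collision_property G"
  unfolding infinite_collision_property_def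
proof
  fix v assume v: "v \<in> verts G"
  let ?L = "pair_law G v v"
  have sets: "last_meet_set n m \<in> sets ?L" "avoid_set m \<in> sets ?L" for n m
    by (simp_all add: sets_pair_law last_meet_set_sets avoid_set_sets)
  have "AE z in ?L. z \<notin> (\<Inter>m. last_meet_set n m)" for n
  proof (rule AE_not_in)
    have "emeasure ?L (\<Inter>m. last_meet_set n m) \<le> (INF m. last_coll G n m v v)"
      by (intro INF_greatest) (auto simp flip: emeasure_last_meet_set intro: emeasure_mono sets)
    then have "emeasure ?L (\<Inter>m. last_meet_set n m) = 0" using last[OF v] by simp
    moreover have "(\<Inter>m. last_meet_set n m) \<in> sets ?L"
      using sets(1)[of n] by (intro sets.countable_INT) auto
    ultimately show "(\<Inter>m. last_meet_set n m) \<in> null_sets ?L" by (rule null_setsI)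
  qed
  then have "AE z in ?L. \<forall>n. z \<notin> (\<Inter>m. last_meet_set n m)" by (simp add: AE_all_countable)
  moreover have "AE z in ?L. z \<notin> avoid_set (Suc 0)"
    by (intro AE_not_in null_setsI sets) (simp add: emeasure_avoid_set)
  ultimately show "AE (x, y) in ?L. \<exists>\<^sub>\<infinity>n. x n = y n"
  proof eventually_elim
    case (elim z)
    obtain x y where z: "z = (x, y)" by force
    have x0: "x 0 = y 0" using elim(2) by (auto simp: z avoid_set_def)
    have next_meet: "\<exists>k>n. x k = y k" if meet: "x n = y n" for n
    proof -
      obtain m where "(x, y) \<notin> last_meet_set n m" using elim(1) by (auto simp: z)
      then obtain k where "x (n + Suc k) = y (n + Suc k)"
        using meet by (auto simp: last_meet_set_def)
      then show ?thesis by (intro exI[of _ "n + Suc k"]) auto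
    qed
    have "\<exists>k\<ge>N. x k = y k" for N
    proof (induction N)
      case (Suc N)
      then obtain k where "k \<ge> N" "x k = y k" by auto
      with next_meet[of k] show ?case by (metis less_le_trans not_less_eq_eq not_less order_le_less_trans)
    qed (use x0 in auto)
    then show ?case by (simp add: z INFM_nat_le)
  qed
qed

section \<open>Locality and measurability\<close>

text \<open>\<open>C k\<close> is a set of vertices from which \<open>k\<close> steps of the walk are carried to \<open>H\<close> by \<open>\<phi>\<close>:
  for an isomorphism of balls of radius \<open>r\<close> it is the ball of radius \<open>r - k\<close>, for an isomorphism
  of graphs all of \<open>G\<close>.\<close>

definition walk_map ::
    "('v \<Rightarrow> 'w) \<Rightarrow> 'v multigraph \<Rightarrow> 'w multigraph \<Rightarrow> (nat \<Rightarrow> 'v set) \<Rightarrow> bool" where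
  "walk_map \<phi> G H C \<longleftrightarrow> inj_on \<phi> (C 0) \<and> (\<forall>k. C (Suc k) \<subseteq> C k \<and> (\<forall>a\<in>C (Suc k).
     deg H (\<phi> a) = deg G a \<and> srw_step H (\<phi> a) = map_pmf \<phi> (srw_step G a) \<and>
     set_pmf (srw_step G a) \<subseteq> C k))"

lemma walk_map_antimono:
  assumes "walk_map \<phi> G H C" "m \<le> n" "a \<in> C n"
  shows "a \<in> C m"
proof -
  have "antimono C" using assms(1) by (auto simp: walk_map_def intro!: decseq_SucI)
  then show ?thesis using assms(2,3) by (auto simp: antimono_def)
qed

lemma walk_map_step:
  assumes "walk_map \<phi> G H C" "a \<in> C (Suc k)"
  shows "deg H (\<phi> a) = deg G a" "srw_step H (\<phi> a) = map_pmf \<phi> (srw_step G a)"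
    "set_pmf (srw_step G a) \<subseteq> C k"
  using assms by (auto simp: walk_map_def)

lemma walk_map_eq_iff:
  assumes "walk_map \<phi> G H C" "a \<in> C m" "b \<in> C n"
  shows "\<phi> a = \<phi> b \<longleftrightarrow> a = b"
  using walk_map_antimono[OF assms(1) le0] assms by (auto simp: walk_map_def inj_on_def)

text \<open>Only the start \<open>a\<close> needs room for \<open>n\<close> steps. The target
  \<open>b\<close> may lie in any level, since it is only compared with endpoints in
  \<open>C 0\<close>, where \<phi> is injective.\<close>

lemma trans_prob_walk_map:
  assumes "walk_map \<phi> G H C" "a \<in> C n" "b \<in> C m"
  shows "trans_prob H n (\<phi> a) (\<phi> b) = trans_prob G n a b"
  using assms(2)
proof (induction n arbitrary: a)
  case 0
  then show ?case using walk_map_eq_iff[OF assms(1) _ assms(3)] by auto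
next
  case (Suc n)
  note step = walk_map_step[OF assms(1) Suc.prems]
  have "(\<integral>\<^sup>+z. trans_prob H n (\<phi> z) (\<phi> b) \<partial>srw_step G a) =
      (\<integral>\<^sup>+z. trans_prob G n z b \<partial>srw_step G a)"
    using step(3) Suc.IH by (intro nn_integral_cong_AE) (auto simp: AE_measure_pmf_iff)
  then show ?case by (simp add: step(2))
qed

lemma no_coll_walk_map:
  assumes "walk_map \<phi> G H C" "a \<in> C m" "b \<in> C m"
  shows "no_coll H m (\<phi> a) (\<phi> b) = no_coll G m a b"
  using assms(2,3)
proof (induction m arbitrary: a b)
  case (Suc m)
  note a = walk_map_step[OF assms(1) Suc.prems(1)] and b = walk_map_step[OF assms(1) Suc.prems(2)]
  have "(\<integral>\<^sup>+z. \<integral>\<^sup>+w. (if \<phi> z = \<phi> w then 0 else no_coll H m (\<phi> z) (\<phi> w)) \<partial>srw_step G b \<partial>srw_step G a) =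
      (\<integral>\<^sup>+z. \<integral>\<^sup>+w. (if z = w then 0 else no_coll G m z w) \<partial>srw_step G b \<partial>srw_step G a)"
    using a(3) b(3) Suc.IH walk_map_eq_iff[OF assms(1), of _ m _ m]
    by (intro nn_integral_cong_AE) (auto simp: AE_measure_pmf_iff subset_iff intro!: nn_integral_cong_AE)
  then show ?case by (simp add: a(2) b(2))
qed simp

lemma last_coll_walk_map:
  assumes "walk_map \<phi> G H C" "a \<in> C (n + m)" "b \<in> C (n + m)"
  shows "last_coll H n m (\<phi> a) (\<phi> b) = last_coll G n m a b"
  using assms(2,3)
proof (induction n arbitrary: a b)
  case 0
  then show ?case using walk_map_eq_iff[OF assms(1)] no_coll_walk_map[OF assms(1)] by auto
next
  case (Suc n)
  then have "a \<in> C (Suc (n + m))" "b \<in> C (Suc (n + m))" by auto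
  note a = walk_map_step[OF assms(1) this(1)] and b = walk_map_step[OF assms(1) this(2)]
  have "(\<integral>\<^sup>+z. \<integral>\<^sup>+w. last_coll H n m (\<phi> z) (\<phi> w) \<partial>srw_step G b \<partial>srw_step G a) =
      (\<integral>\<^sup>+z. \<integral>\<^sup>+w. last_coll G n m z w \<partial>srw_step G b \<partial>srw_step G a)"
    using a(3) b(3) Suc.IH
    by (intro nn_integral_cong_AE) (auto simp: AE_measure_pmf_iff subset_iff intro!: nn_integral_cong_AE)
  then show ?case by (simp add: a(2) b(2))
qed

section \<open>Walk steps under isomorphisms of graphs and of balls\<close>

lemma set_srw_step:
  assumes "finite {v. nedges G u v > 0}"
  shows "set_pmf (srw_step G u) = (if deg G u = 0 then {u} else {v. nedges G u v > 0})"
proof (cases "deg G u = 0")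
  case True
  then show ?thesis by (simp add: srw_step_def)
next
  case False
  then show ?thesis by (auto simp: set_pmf_eq pmf_srw_step[OF assms])
qed

text \<open>Edges are only matched inside \<open>A\<close> and \<open>B\<close>. Requiring all
  neighbours of \<open>a\<close> and of its image to lie there ensures that no edge is lost at the
  boundary.\<close>

lemma srw_step_iso:
  assumes bij: "bij_betw \<phi> A B"
    and edges: "\<And>x y. x \<in> A \<Longrightarrow> y \<in> A \<Longrightarrow> nedges H (\<phi> x) (\<phi> y) = nedges G x y"
    and a: "a \<in> A" and nG: "{v. nedges G a v > 0} \<subseteq> A" and nH: "{v. nedges H (\<phi> a) v > 0} \<subseteq> B"
    and fin: "finite {v. nedges G a v > 0}"
  shows "deg H (\<phi> a) = deg G a" "srw_step H (\<phi> a) = map_pmf \<phi> (srw_step G a)"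
proof -
  have nbrs: "{v. nedges H (\<phi> a) v > 0} = \<phi> ` {v. nedges G a v > 0}"
  proof (intro set_eqI iffI)
    fix y assume y: "y \<in> {v. nedges H (\<phi> a) v > 0}"
    then obtain x where "x \<in> A" "y = \<phi> x" using nH bij by (auto simp: bij_betw_def)
    with y edges[OF a] show "y \<in> \<phi> ` {v. nedges G a v > 0}" by auto
  qed (use nG edges[OF a] in auto)
  have inj: "inj_on \<phi> {v. nedges G a v > 0}"
    using bij nG by (auto simp: bij_betw_def intro: inj_on_subset)
  show deg: "deg H (\<phi> a) = deg G a"
    unfolding deg_def nbrs sum.reindex[OF inj] using nG edges[OF a] by (intro sum.cong) auto
  show "srw_step H (\<phi> a) = map_pmf \<phi> (srw_step G a)"
  proof (cases "deg G a = 0")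
    case True
    then show ?thesis using deg by (simp add: srw_step_def)
  next
    case False
    have finH: "finite {v. nedges H (\<phi> a) v > 0}" using fin nbrs by simp
    have supp: "set_pmf (srw_step G a) =
        {v. nedges G a v > 0}" using False set_srw_step[OF fin] by simp
    show ?thesis
    proof (rule pmf_eqI)
      fix y
      show "pmf (srw_step H (\<phi> a)) y = pmf (map_pmf \<phi> (srw_step G a)) y"
      proof (cases "y \<in> \<phi> ` {v. nedges G a v > 0}")
        case True
        then obtain x where x: "nedges G a x > 0" "y = \<phi> x" by auto
        then have "pmf (map_pmf \<phi> (srw_step G a)) y = pmf (srw_step G a) x"
          using pmf_map_inj[of \<phi> "srw_step G a" x] inj supp by simp
        moreover have "nedges H (\<phi> a) (\<phi> x) = nedges G a x" using x nG edges[OF a] by auto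
        ultimately show ?thesis
          using x False deg by (simp add: pmf_srw_step[OF fin] pmf_srw_step[OF finH])
      next
        case y: False
        then have "nedges H (\<phi> a) y = 0" unfolding nbrs[symmetric] by simp
        then show ?thesis
          using pmf_map_outside[of y \<phi> "srw_step G a"] y supp False deg by (simp add: pmf_srw_step[OF finH])
      qed
    qed
  qed
qed

lemma walk_map_graph_iso:
  assumes G: "conn_lf_graph G" and H: "wf_multigraph H"
    and iso: "graph_iso \<phi> G H"
  shows "walk_map \<phi> G H (\<lambda>k. verts G)"
proof -
  have bij: "bij_betw \<phi> (verts G) (verts H)"
    and edges: "\<And>x y. x \<in> verts G \<Longrightarrow> y \<in> verts G \<Longrightarrow> nedges H (\<phi> x) (\<phi> y) = nedges G x y"
    using iso by (auto simp: graph_iso_def)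
  have wf: "{v. nedges G a v > 0} \<subseteq> verts G" "{v. nedges H b v > 0} \<subseteq> verts H" for a b
    using G H by (auto simp: conn_lf_graph_def wf_multigraph_def)
  have fin: "finite {v. nedges G a v > 0}" if "a \<in> verts G" for a
    using G that by (auto simp: conn_lf_graph_def locally_finite_def)
  show ?thesis
    unfolding walk_map_def
    using bij srw_step_iso[OF bij edges _ wf fin] wf(1) set_srw_step[OF fin]
    by (auto simp: bij_betw_def split: if_splits)
qed

lemma ball_verts_step:
  assumes "wf_multigraph G" "a \<in> ball_verts G us s" "nedges G a b > 0"
  shows "b \<in> ball_verts G us (Suc s)"
proof -
  obtain u n where "u \<in> set us" "n \<le> s" "(u, a) \<in> adj G ^^ n" using assms(2) by (auto simp: ball_verts_def)
  moreover have "(a, b) \<in> adj G" "b \<in> verts G" using assms(1,3) by (auto simp: adj_def wf_multigraph_def)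
  ultimately show ?thesis
    by (auto simp: ball_verts_def intro!: bexI[of _ u] exI[of _ "Suc n"])
qed

lemma ball_verts_mono: "s \<le> r \<Longrightarrow> ball_verts G us s \<subseteq> ball_verts G us r"
  by (auto simp: ball_verts_def) (meson order_trans)

text \<open>From radius \<open>r - Suc k\<close> all neighbours lie within radius
  \<open>r - k\<close>, in \<open>G\<close> as well as in \<open>H\<close>, so a step of the walk is
  preserved. The levels beyond \<open>r\<close> are set to empty because truncated subtraction would
  keep the roots in every level.\<close>

lemma walk_map_ball_iso:
  assumes G: "wf_multigraph G" "locally_finite G" and H: "wf_multigraph H"
    and us: "set us \<subseteq> verts G" 
    and iso: "graph_iso \<phi> (graph_ball G us r) (graph_ball H (map \<phi> us) r)"
  shows "walk_map \<phi> G H (\<lambda>k. if k \<le> r then ball_verts G us (r - k) else {})"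
proof -
  let ?A = "ball_verts G us r" and ?B = "ball_verts H (map \<phi> us) r"
  have bij: "bij_betw \<phi> ?A ?B"
    using iso by (auto simp: graph_iso_def graph_ball_def Let_def)
  have edges: "nedges H (\<phi> x) (\<phi> y) = nedges G x y" if "x \<in> ?A" "y \<in> ?A" for x y
  proof -
    have "\<phi> x \<in> ?B" "\<phi> y \<in> ?B" using that bij by (auto simp: bij_betw_def)
    then show ?thesis using iso that unfolding graph_iso_def graph_ball_def Let_def by simp metis
  qed
  have step: "deg H (\<phi> a) = deg G a \<and> srw_step H (\<phi> a) = map_pmf \<phi> (srw_step G a) \<and>
      set_pmf (srw_step G a) \<subseteq> ball_verts G us (r - k)"
    if "Suc k \<le> r" "a \<in> ball_verts G us (r - Suc k)" for a k
  proof -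
    have Suc: "Suc (r - Suc k) = r - k" using that(1) by simp
    have a: "a \<in> ?A" "a \<in> ball_verts G us (r - k)"
      by (rule subsetD[OF ball_verts_mono that(2)], simp)+
    then have fin: "finite {v. nedges G a v > 0}" using G(2) by (auto simp: locally_finite_def ball_verts_def)
    have nbrs: "{v. nedges G a v > 0} \<subseteq> ball_verts G us (r - k)"
      using ball_verts_step[OF G(1) that(2)] by (auto simp: Suc)
    have "\<phi> a \<in> ball_verts H (map \<phi> us) (r - Suc k)"
      using graph_ball_iso_verts_mono[OF iso G(1) H us, of "r - Suc k"] that by auto
    from ball_verts_step[OF H this] have nbrsH: "{v. nedges H (\<phi> a) v > 0} \<subseteq> ball_verts H (map \<phi> us) (r - k)"
      by (auto simp: Suc)
    have "{v. nedges G a v > 0} \<subseteq> ?A" "{v. nedges H (\<phi> a) v > 0} \<subseteq> ?B"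
      using nbrs nbrsH ball_verts_mono[of "r - k" r] by (meson diff_le_self order_trans)+
    from srw_step_iso[OF bij edges a(1) this fin] show ?thesis
      using nbrs a(2) set_srw_step[OF fin] by simp
  qed
  have mono: "ball_verts G us (r - Suc k) \<subseteq> ball_verts G us (r - k)" for k
    by (rule ball_verts_mono) simp
  show ?thesis
    unfolding walk_map_def using bij step mono by (auto simp: bij_betw_def subset_iff split: if_splits)
qed

section \<open>Functionals determined by a ball of fixed radius\<close>

definition local_functional :: "(nat multigraph \<Rightarrow> nat \<Rightarrow> nat \<Rightarrow> 'b) \<Rightarrow> bool" where
  "local_functional \<Phi> \<longleftrightarrow> (\<exists>N. \<forall>\<phi> G H C u v. walk_map \<phi> G H C \<longrightarrow> u \<in> C N \<longrightarrow> v \<in> C N \<longrightarrow>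
     \<Phi> H (\<phi> u) (\<phi> v) = \<Phi> G u v)"

lemma local_functionalI:
  assumes "\<And>\<phi> G H C u v. walk_map \<phi> G H C \<Longrightarrow> u \<in> C N \<Longrightarrow> v \<in> C N \<Longrightarrow> \<Phi> H (\<phi> u) (\<phi> v) = \<Phi> G u v"
  shows "local_functional \<Phi>"
  using assms unfolding local_functional_def by blast

lemma local_functional_basic:
  "local_functional (\<lambda>G u v. of_nat (deg G u) :: ennreal)"
  "local_functional (\<lambda>G u v. trans_prob G n u v)"
  "local_functional (\<lambda>G u v. no_coll G m v v)"
  "local_functional (\<lambda>G u v. last_coll G n m u v)"
proof -
  show "local_functional (\<lambda>G u v. of_nat (deg G u) :: ennreal)"
    by (rule local_functionalI[where N = "Suc 0"]) (simp add: walk_map_step)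
  show "local_functional (\<lambda>G u v. trans_prob G n u v)"
    by (rule local_functionalI[where N = n]) (rule trans_prob_walk_map)
  show "local_functional (\<lambda>G u v. no_coll G m v v)"
    by (rule local_functionalI[where N = m]) (rule no_coll_walk_map)
  show "local_functional (\<lambda>G u v. last_coll G n m u v)"
    by (rule local_functionalI[where N = "n + m"]) (rule last_coll_walk_map)
qed

text \<open>The number \<open>N\<close> of steps is uniform in the graph and serves as the radius:
  the roots lie in level \<open>N\<close>, the ball of radius 0. The root list with indices
  \<open>i\<close> and \<open>j\<close> treats one root and two roots together.\<close>

lemma local_functional_ball:
  fixes \<Phi> :: "nat multigraph \<Rightarrow> nat \<Rightarrow> nat \<Rightarrow> 'b"
  assumes "local_functional \<Phi>"
  obtains r where "\<And>(G :: nat multigraph) (H :: nat multigraph) us vs. conn_lf_graph G \<Longrightarrow> conn_lf_graph H \<Longrightarrow> set us \<subseteq> verts G \<Longrightarrow>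
    rooted_iso (graph_ball G us r) us (graph_ball H vs r) vs \<Longrightarrow>
    i < length us \<Longrightarrow> j < length us \<Longrightarrow> \<Phi> G (us ! i) (us ! j) = \<Phi> H (vs ! i) (vs ! j)"
proof -
  obtain N where N: "\<And>\<phi> G H C u v. walk_map \<phi> G H C \<Longrightarrow> u \<in> C N \<Longrightarrow> v \<in> C N \<Longrightarrow>
      \<Phi> H (\<phi> u) (\<phi> v) = \<Phi> G u v"
    using assms unfolding local_functional_def by blast
  show ?thesis
  proof (rule that[of N])
    fix G H :: "nat multigraph" and us vs
    assume *: "conn_lf_graph G" "conn_lf_graph H" "set us \<subseteq> verts G" "i < length us" "j < length us"
      "rooted_iso (graph_ball G us N) us (graph_ball H vs N) vs"
    then obtain \<phi> where \<phi>: "graph_iso \<phi> (graph_ball G us N) (graph_ball H (map \<phi> us) N)" "vs = map \<phi> us"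
      by (auto simp: rooted_iso_def)
    have "us ! k \<in> ball_verts G us (N - N)" if "k < length us" for k
      using that *(3) nth_mem[OF that] by (auto simp: ball_verts_def intro!: bexI[of _ "us ! k"])
    moreover have "walk_map \<phi> G H (\<lambda>k. if k \<le> N then ball_verts G us (N - k) else {})"
      using * \<phi> by (intro walk_map_ball_iso) (auto simp: conn_lf_graph_def)
    ultimately show "\<Phi> G (us ! i) (us ! j) = \<Phi> H (vs ! i) (vs ! j)"
      using N *(4,5) by (simp add: \<phi>(2))
  qed
qed

text \<open>The functional takes the same value on graphs with isomorphic balls of radius
  \<open>r\<close>, so the preimage of any set whatsoever is open.\<close>

lemma borel_measurable_rooted:
  fixes \<Phi> :: "nat multigraph \<Rightarrow> nat \<Rightarrow> nat \<Rightarrow> 'b::topological_space"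
  assumes "local_functional \<Phi>"
  shows "(\<lambda>x. \<Phi> (graph_of x) (root_of x) (root_of x)) \<in> borel_measurable borel"
proof -
  obtain r where r: "\<And>G H us vs. conn_lf_graph G \<Longrightarrow> conn_lf_graph H \<Longrightarrow> set us \<subseteq> verts G \<Longrightarrow>
    rooted_iso (graph_ball G us r) us (graph_ball H vs r) vs \<Longrightarrow>
    0 < length us \<Longrightarrow> 0 < length us \<Longrightarrow> \<Phi> G (us ! 0) (us ! 0) = \<Phi> H (vs ! 0) (vs ! 0)"
    using local_functional_ball[OF assms, of 0 0] by blast
  let ?h = "\<lambda>x. \<Phi> (graph_of x) (root_of x) (root_of x)"
  have eq: "?h x = ?h y" if "rooted_balls_iso r x y" for x y
    using r[of "graph_of x" "graph_of y" "[root_of x]" "[root_of y]"] that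
      graph_of_root_of[of x] graph_of_root_of[of y]
    by (simp add: rooted_balls_iso_def graph_of_def root_of_def case_prod_unfold)
  have "open (?h -` S)" for S
    unfolding open_rooted_graph_def
  proof
    fix x assume x: "x \<in> ?h -` S"
    have "y \<in> ?h -` S" if "rooted_balls_iso r x y" for y using eq[OF that] x by simp
    then show "\<exists>r. \<forall>y. rooted_balls_iso r x y \<longrightarrow> y \<in> ?h -` S" by blast
  qed
  then show ?thesis by (intro borel_measurableI) simp
qed

lemma borel_measurable_birooted:
  fixes \<Phi> :: "nat multigraph \<Rightarrow> nat \<Rightarrow> nat \<Rightarrow> 'b::topological_space"
  assumes "local_functional \<Phi>"
  shows "(\<lambda>z. case rep_birooted_graph z of (G, u, v) \<Rightarrow> \<Phi> G u v) \<in>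
      borel_measurable borel"
proof -
  obtain r where r: "\<And>G H us vs. conn_lf_graph G \<Longrightarrow> conn_lf_graph H \<Longrightarrow> set us \<subseteq> verts G \<Longrightarrow>
    rooted_iso (graph_ball G us r) us (graph_ball H vs r) vs \<Longrightarrow>
    0 < length us \<Longrightarrow> 1 < length us \<Longrightarrow> \<Phi> G (us ! 0) (us ! 1) = \<Phi> H (vs ! 0) (vs ! 1)"
    using local_functional_ball[OF assms, of 0 1] by blast
  let ?h = "\<lambda>z. case rep_birooted_graph z of (G, u, v) \<Rightarrow> \<Phi> G u v"
  have eq: "?h x = ?h y" if "birooted_balls_iso r x y" for x y
  proof -
    obtain G u v where x: "rep_birooted_graph x = (G, u, v)" by (cases "rep_birooted_graph x") auto
    obtain H u' v' where y: "rep_birooted_graph y = (H, u', v')" by (cases "rep_birooted_graph y") auto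
    show ?thesis
      using r[of G H "[u, v]" "[u', v']"] that rep_birooted_graph_wf[of x] rep_birooted_graph_wf[of y]
      by (simp add: x y birooted_balls_iso_def)
  qed
  have "open (?h -` S)" for S
    unfolding open_birooted_graph_def
  proof
    fix x assume x: "x \<in> ?h -` S"
    have "y \<in> ?h -` S" if "birooted_balls_iso r x y" for y using eq[OF that] x by simp
    then show "\<exists>r. \<forall>y. birooted_balls_iso r x y \<longrightarrow> y \<in> ?h -` S" by blast
  qed
  then show ?thesis by (intro borel_measurableI) simp
qed

text \<open>The chosen representative is in general a different graph, but an isomorphism to it
  carries walks of any length; hence the constant family of levels.\<close>

lemma rep_birooted:
  assumes "conn_lf_graph G" "u \<in> verts G" "v \<in> verts G"
  obtains \<phi> H where "rep_birooted_graph (birooted G u v) = (H, \<phi> u, \<phi> v)"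
    "walk_map \<phi> G H (\<lambda>k. verts G)"
proof -
  have refl: "birooted_equiv (G, u, v) (G, u, v)"
    using assms by (simp add: birooted_equiv_def rooted_iso_refl)
  have "birooted_equiv (G, u, v) (rep_birooted_graph (birooted G u v))"
    unfolding birooted_def
    using Quotient3_rep_abs[OF Quotient3_birooted_graph refl] birooted_graph_equivp
    by (meson part_equivp_symp)
  then obtain H x y where H: "rep_birooted_graph (birooted G u v) = (H, x, y)" "conn_lf_graph H"
    "rooted_iso G [u, v] H [x, y]"
    by (cases "rep_birooted_graph (birooted G u v)") (auto simp: birooted_equiv_def)
  then obtain \<phi> where "graph_iso \<phi> G H" "x = \<phi> u" "y = \<phi> v" by (auto simp: rooted_iso_def)
  with H show ?thesis using walk_map_graph_iso[OF assms(1)] that by (auto simp: conn_lf_graph_def)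
qed

section \<open>The mass transport\<close>

definition meet_transport :: "'v multigraph \<Rightarrow> 'v \<Rightarrow> 'v \<Rightarrow> ennreal" where
  "meet_transport G u v = of_nat (deg G u) *
     (\<Sum>n. trans_prob G n u v * trans_prob G n u v * (INF m. no_coll G m v v))"

lemma meet_transport_birooted:
  assumes "conn_lf_graph G" "u \<in> verts G" "v \<in> verts G"
  shows "(case rep_birooted_graph (birooted G u v) of (H, x, y) \<Rightarrow> meet_transport H x y) =
      meet_transport G u v"
proof -
  obtain \<phi> H where H: "rep_birooted_graph (birooted G u v) = (H, \<phi> u, \<phi> v)"
    "walk_map \<phi> G H (\<lambda>k. verts G)" using rep_birooted[OF assms] .
  show ?thesis
    using assms walk_map_step(1)[OF H(2)] trans_prob_walk_map[OF H(2)] no_coll_walk_map[OF H(2)]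
    by (simp add: H(1) meet_transport_def)
qed

text \<open>The transport may depend on the whole graph, but it is built from local functionals by
  products, countable sums and countable infima.\<close>

lemma borel_measurable_meet_transport:
  "(\<lambda>z. case rep_birooted_graph z of (G, u, v) \<Rightarrow> meet_transport G u v) \<in> borel_measurable borel"
  unfolding meet_transport_def case_prod_unfold
  using local_functional_basic[THEN borel_measurable_birooted, unfolded case_prod_unfold]
  by (intro borel_measurable_times_ennreal borel_measurable_suminf_order borel_measurable_INF) simp_all

text \<open>Allows sums over \<open>verts G\<close> to be extended to the whole vertex type.\<close>

lemma trans_prob_outside:
  assumes "conn_lf_graph G" "u \<in> verts G" "v \<notin> verts G"
  shows "trans_prob G n u v = 0"
  using assms(2)
proof (induction n arbitrary: u)
  case 0
  then show ?case using assms by auto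
next
  case (Suc n)
  have fin: "finite {v. nedges G u v > 0}"
    using assms(1) Suc.prems by (auto simp: conn_lf_graph_def locally_finite_def)
  have "set_pmf (srw_step G u) \<subseteq> verts G"
    using set_srw_step[OF fin] assms(1) Suc.prems by (auto simp: conn_lf_graph_def wf_multigraph_def)
  then have "trans_prob G (Suc n) u v = (\<integral>\<^sup>+z. 0 \<partial>srw_step G u)"
    unfolding trans_prob.simps using Suc.IH by (intro nn_integral_cong_AE) (auto simp: AE_measure_pmf_iff)
  then show ?case by simp
qed

lemma meet_transport_out:
  assumes "conn_lf_graph G" "u \<in> verts G"
  shows "(\<integral>\<^sup>+v. meet_transport G u v \<partial>count_space (verts G)) =
    of_nat (deg G u) * (\<Sum>n. INF m. last_coll G n m u u)"
proof -
  have "(\<integral>\<^sup>+v. meet_transport G u v \<partial>count_space (verts G)) =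
      (\<integral>\<^sup>+v. meet_transport G u v \<partial>count_space UNIV)"
    using trans_prob_outside[OF assms] by (intro nn_integral_count_space_eq) (auto simp: meet_transport_def)
  also have "\<dots> = (\<Sum>n. of_nat (deg G u) * (INF m. last_coll G n m u u))"
    unfolding meet_transport_def ennreal_suminf_cmult[symmetric]
    by (subst nn_integral_suminf) (simp_all add: nn_integral_cmult INF_last_coll)
  finally show ?thesis by simp
qed

lemma meet_transport_in:
  assumes "conn_lf_graph G"
  shows "(\<integral>\<^sup>+u. meet_transport G u v \<partial>count_space (verts G)) =
    of_nat (deg G v) * (\<Sum>n. trans_prob G (n + n) v v) * (INF m. no_coll G m v v)"
proof -
  let ?q = "INF m. no_coll G m v v"
  have wf: "wf_multigraph G" "locally_finite G" using assms by (auto simp: conn_lf_graph_def)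
  have "(\<integral>\<^sup>+u. meet_transport G u v \<partial>count_space (verts G)) =
      (\<integral>\<^sup>+u. meet_transport G u v \<partial>count_space UNIV)"
  proof (intro nn_integral_count_space_eq)
    fix u assume "u \<in> UNIV - verts G"
    then have "nedges G u w = 0" for w using wf by (auto simp: wf_multigraph_def)
    then show "meet_transport G u v = 0" by (simp add: meet_transport_def deg_def)
  qed auto
  also have "\<dots> = (\<integral>\<^sup>+u. (\<Sum>n. of_nat (deg G v) * (trans_prob G n v u * trans_prob G n u v) * ?q) \<partial>count_space UNIV)"
  proof (intro nn_integral_cong)
    fix u
    \<comment> \<open>Reversibility is applied to only one of the two equal factors, giving a path
      from \<open>v\<close> to \<open>u\<close> and back. Chapman-Kolmogorov then sums it over
      \<open>u\<close>.\<close>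
    have "of_nat (deg G u) * (trans_prob G n u v * trans_prob G n u v * ?q) =
        of_nat (deg G v) * (trans_prob G n v u * trans_prob G n u v) * ?q" for n
      using trans_prob_reversible[OF wf, of u n v] by (metis mult.assoc)
    then show "meet_transport G u v = (\<Sum>n. of_nat (deg G v) * (trans_prob G n v u * trans_prob G n u v) * ?q)"
      unfolding meet_transport_def ennreal_suminf_cmult[symmetric] by (simp only:)
  qed
  also have "\<dots> = (\<Sum>n. of_nat (deg G v) * trans_prob G (n + n) v v * ?q)"
    by (subst nn_integral_suminf) (simp_all add: nn_integral_multc nn_integral_cmult trans_prob_add)
  finally show ?thesis by simp
qed

section \<open>Return probabilities at even times\<close>

lemma two_mult_le_ennreal:
  fixes a b a' b' d e :: ennreal
  assumes fin: "a < \<top>" "b < \<top>" "a' < \<top>" "b' < \<top>" "d < \<top>" "e < \<top>" and "d \<noteq> 0"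
    and a: "d * a' = e * a" and b: "d * b' = e * b"
  shows "2 * (a * b') \<le> a * a' + b * b'"
proof -
  obtain A B A' B' D E where real: "a = ennreal A" "b = ennreal B" "a' = ennreal A'" "b' = ennreal B'"
    "d = ennreal D" "e = ennreal E" and nonneg: "A \<ge> 0" "B \<ge> 0" "A' \<ge> 0" "B' \<ge> 0" "D \<ge> 0" "E \<ge> 0"
    using fin by (metis less_top ennreal_enn2real enn2real_nonneg)
  have D: "D > 0" using \<open>d \<noteq> 0\<close> nonneg(5) real(5) by auto
  have eqs: "D * A' = E * A" "D * B' = E * B"
    using a b nonneg by (auto simp: real simp flip: ennreal_mult)
  \<comment> \<open>Primed and unprimed quantities are proportional with the same factor, so the
    inequality becomes the nonnegativity of a multiple of \<open>(A - B)\<^sup>2\<close>.\<close>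
  have "A' = E / D * A" "B' = E / D * B" using eqs D by (auto simp: field_simps)
  then have "A * A' + B * B' - 2 * (A * B') = E / D * (A - B)\<^sup>2"
    by (simp add: power2_eq_square algebra_simps)
  moreover have "E / D * (A - B)\<^sup>2 \<ge> 0" using nonneg by simp
  ultimately have "2 * (A * B') \<le> A * A' + B * B'" by linarith
  then have "ennreal (2 * (A * B')) \<le> ennreal (A * A' + B * B')" by (rule ennreal_leI)
  then show ?thesis using nonneg by (simp add: real ennreal_mult)
qed

text \<open>By reversibility \<open>p\<^sub>2\<^sub>n\<^sub>+\<^sub>1(v,v)\<close> is an inner product of \<open>p\<^sub>n(v,\<cdot>)\<close> and \<open>p\<^sub>n\<^sub>+\<^sub>1(v,\<cdot>)\<close>. Hence the
  expected number of returns at even times is already infinite.\<close>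

lemma trans_prob_odd_le:
  assumes G: "conn_lf_graph G" and v: "deg G v \<noteq> 0"
  shows "2 * trans_prob G (n + Suc n) v v \<le>
      trans_prob G (n + n) v v + trans_prob G (Suc n + Suc n) v v"
proof -
  have wf: "wf_multigraph G" "locally_finite G" using G by (auto simp: conn_lf_graph_def)
  have "2 * (trans_prob G n v u * trans_prob G (Suc n) u v) \<le>
      trans_prob G n v u * trans_prob G n u v + trans_prob G (Suc n) v u * trans_prob G (Suc n) u v" for u
  proof (cases "deg G u = 0")
    case True
    then have "trans_prob G n v u = 0"
      using trans_prob_reversible[OF wf, of u n v] v by simp
    then show ?thesis by simp
  next
    \<comment> \<open>Here a = p_n(v,u), b = p_(n+1)(v,u), and primes reverse the two vertices. The
      degrees \<open>d\<close> of \<open>u\<close> and \<open>e\<close> of \<open>v\<close> give the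
      two proportionalities by reversibility; the case split ensures that \<open>d\<close> is
      nonzero.\<close>
    case False
    have "trans_prob G k x y < \<top>" for k x y
      using trans_prob_le_1[of G k x y] by (simp add: order_le_less_trans)
    then show ?thesis
      using False trans_prob_reversible[OF wf, of u _ v]
      by (intro two_mult_le_ennreal[where d = "of_nat (deg G u)" and e = "of_nat (deg G v)"])
        (simp_all add: of_nat_less_top del: trans_prob.simps)
  qed
  then have "(\<integral>\<^sup>+u. 2 * (trans_prob G n v u * trans_prob G (Suc n) u v) \<partial>count_space UNIV) \<le>
      (\<integral>\<^sup>+u. trans_prob G n v u * trans_prob G n u v + trans_prob G (Suc n) v u * trans_prob G (Suc n) u v \<partial>count_space UNIV)"
    by (intro nn_integral_mono)
  then show ?thesis
    unfolding trans_prob_add by (simp add: nn_integral_add nn_integral_cmult del: trans_prob.simps)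
qed

lemma suminf_even_trans_prob:
  assumes G: "conn_lf_graph G" and v: "deg G v \<noteq> 0" and inf: "(\<Sum>n. trans_prob G n v v) = \<infinity>"
  shows "(\<Sum>n. trans_prob G (n + n) v v) = \<infinity>"
proof (rule ccontr)
  let ?p = "\<lambda>n. trans_prob G n v v"
  assume fin: "(\<Sum>n. ?p (n + n)) \<noteq> \<infinity>"
  have le: "(\<Sum>n. ?p (Suc n + Suc n)) \<le> (\<Sum>n. ?p (n + n))"
    using suminf_offset[of "\<lambda>n. ?p (n + n)" 1] by (simp del: trans_prob.simps)
  \<comment> \<open>Each odd-time term is controlled by its two even neighbours, so the odd sum is
    at most the even sum plus the even sum without its first term.\<close>
  have "(\<Sum>n. ?p (n + Suc n)) \<le> (\<Sum>n. 2 * ?p (n + Suc n))"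
    by (intro suminf_le) (auto simp: mult_2 simp del: trans_prob.simps)
  also have "\<dots> \<le> (\<Sum>n. ?p (n + n) + ?p (Suc n + Suc n))"
    by (intro suminf_le trans_prob_odd_le G v) auto
  also have "\<dots> = (\<Sum>n. ?p (n + n)) + (\<Sum>n. ?p (Suc n + Suc n))"
    by (intro suminf_add[symmetric]) auto
  also have "\<dots> < \<infinity>" using fin le by (auto simp: less_top[symmetric] top_unique)
  finally have odd: "(\<Sum>n. ?p (n + Suc n)) < \<infinity>" .
  have "(\<lambda>n. sum ?p {n * 2 ..< n * 2 + 2}) sums (\<Sum>n. ?p n)"
    by (intro sums_group summable_sums) auto
  moreover have "sum ?p {n * 2 ..< n * 2 + 2} = ?p (n + n) + ?p (n + Suc n)" for n
    by (simp add: mult_2_right atLeastLessThanSuc numeral_2_eq_2 del: trans_prob.simps)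
  ultimately have "(\<Sum>n. ?p n) = (\<Sum>n. ?p (n + n) + ?p (n + Suc n))" by (simp add: sums_iff)
  also have "\<dots> = (\<Sum>n. ?p (n + n)) + (\<Sum>n. ?p (n + Suc n))"
    by (intro suminf_add[symmetric]) auto
  also have "\<dots> < \<infinity>" using fin odd by (auto simp: less_top[symmetric])
  finally show False using inf by simp
qed

section \<open>From vanishing at one vertex to the whole graph\<close>

lemma trans_prob_positive:
  assumes G: "conn_lf_graph G" and "u \<in> verts G" "v \<in> verts G"
  obtains n where "trans_prob G n u v \<noteq> 0"
proof -
  have "(u, v) \<in> (adj G)\<^sup>*" using assms by (auto simp: conn_lf_graph_def connected_graph_def)
  then have "\<exists>n. trans_prob G n u v \<noteq> 0"
  proof induction
    case base
    have "trans_prob G 0 u u \<noteq> 0" by simp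
    then show ?case by blast
  next
    case (step x y)
    then obtain n where n: "trans_prob G n u x \<noteq> 0" by blast
    have xy: "nedges G x y > 0" using step(2) by (simp add: adj_def)
    have "x \<in> verts G" using G xy by (auto simp: conn_lf_graph_def wf_multigraph_def)
    then have fin: "finite {v. nedges G x v > 0}" using G by (auto simp: conn_lf_graph_def locally_finite_def)
    \<comment> \<open>A path reaching \<open>x\<close> with positive probability is extended by the
      edge to \<open>y\<close>, which has positive step probability.\<close>
    have "trans_prob G (n + Suc 0) u y \<noteq> 0"
    proof
      assume "trans_prob G (n + Suc 0) u y = 0"
      then have "trans_prob G n u x * trans_prob G (Suc 0) x y = 0"
        unfolding trans_prob_add by (simp add: nn_integral_0_iff_AE AE_count_space del: trans_prob.simps)
      then have "pmf (srw_step G x) y = 0" using n by (simp add: trans_prob_1 del: trans_prob.simps)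
      moreover have "deg G x \<noteq> 0" using fin xy by (auto simp: deg_def)
      ultimately show False using xy by (simp add: pmf_srw_step[OF fin])
    qed
    then show ?case by blast
  qed
  then show ?thesis using that by blast
qed

lemma infinite_collision_property_if_no_coll_0:
  fixes G :: "'v::countable multigraph"
  assumes G: "conn_lf_graph G" and q: "\<And>v. v \<in> verts G \<Longrightarrow> (INF m. no_coll G m v v) = 0"
  shows "infinite_collision_property G"
proof (rule infinite_collision_propertyI)
  fix u n assume "u \<in> verts G"
  then have "trans_prob G n u v * trans_prob G n u v * (INF m. no_coll G m v v) = 0" for v
    using q trans_prob_outside[OF G] by (cases "v \<in> verts G") auto
  then show "(INF m. last_coll G n m u u) = 0" by (simp only: INF_last_coll) simp
qed

text \<open>For suitable \<open>n\<close>, both walks from \<open>u\<close> are at \<open>v\<close>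
  at time \<open>n\<close> with positive probability. Were q(v) positive, this meeting would be the
  last one with positive probability.\<close>

lemma infinite_collision_property_if_last_coll_0:
  fixes G :: "'v::countable multigraph"
  assumes G: "conn_lf_graph G" "u \<in> verts G" and zero: "(\<Sum>n. INF m. last_coll G n m u u) = 0"
  shows "infinite_collision_property G"
proof (rule infinite_collision_property_if_no_coll_0[OF G(1)])
  fix v assume "v \<in> verts G"
  then obtain n where n: "trans_prob G n u v \<noteq> 0" using trans_prob_positive[OF G] by blast
  have "(INF m. last_coll G n m u u) = 0" using zero by (simp add: suminf_eq_zero_iff)
  then have "trans_prob G n u v * trans_prob G n u v * (INF m. no_coll G m v v) = 0"
    by (simp add: INF_last_coll nn_integral_0_iff_AE AE_count_space)
  then show "(INF m. no_coll G m v v) = 0" using n by simp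
qed

text \<open>By connectedness \<open>G\<close> is a single vertex without edges, where the walk stays
  put. The case is separate because the mass sent out has the factor \<open>deg G u\<close> and
  carries no information when it is 0.\<close>

lemma infinite_collision_property_if_deg_0:
  fixes G :: "'v::countable multigraph"
  assumes G: "conn_lf_graph G" "u \<in> verts G" and "deg G u = 0"
  shows "infinite_collision_property G"
proof (rule infinite_collision_property_if_no_coll_0[OF G(1)])
  fix v assume "v \<in> verts G"
  then have path: "(u, v) \<in> (adj G)\<^sup>*" using G by (auto simp: conn_lf_graph_def connected_graph_def)
  have "finite {v. nedges G u v > 0}" using G by (auto simp: conn_lf_graph_def locally_finite_def)
  then have "(u, w) \<notin> adj G" for w using \<open>deg G u = 0\<close> by (auto simp: deg_def adj_def)
  then have "v = u" using path by (auto elim: converse_rtranclE)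
  then have "no_coll G (Suc 0) v v = 0" using \<open>deg G u = 0\<close> by (simp add: srw_step_def)
  then show "(INF m. no_coll G m v v) = 0" by (metis INF_lower UNIV_I le_zero_eq)
qed

theorem theorem4:
  fixes M :: "'w measure" and X :: "'w \<Rightarrow> rooted_graph"
  assumes "random_rooted_graph M X"
    and "unimodular M X"
    and "AE \<omega> in M. recurrent (graph_of (X \<omega>))"
    and "(\<integral>\<^sup>+\<omega>. of_nat (deg (graph_of (X \<omega>)) (root_of (X \<omega>))) \<partial>M) < \<infinity>"
  shows "AE \<omega> in M. infinite_collision_property (graph_of (X \<omega>))"
proof -
  have X[measurable]: "X \<in> M \<rightarrow>\<^sub>M borel" using assms(1) by (simp add: random_rooted_graph_def)
  define G where "G \<omega> = graph_of (X \<omega>)" for \<omega>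
  define \<rho> where "\<rho> \<omega> = root_of (X \<omega>)" for \<omega>
  have G: "conn_lf_graph (G \<omega>)" "\<rho> \<omega> \<in> verts (G \<omega>)" for \<omega>
    by (simp_all add: G_def \<rho>_def graph_of_root_of)
  \<comment> \<open>\<open>S\<close> is the mass sent out by the root and \<open>R\<close> the mass
    it receives, both after summation over the other vertex.\<close>
  define S where "S \<omega> = of_nat (deg (G \<omega>) (\<rho> \<omega>)) * (\<Sum>n. INF m. last_coll (G \<omega>) n m (\<rho> \<omega>) (\<rho> \<omega>))" for \<omega>
  define R where "R \<omega> = of_nat (deg (G \<omega>) (\<rho> \<omega>)) * (\<Sum>n. trans_prob (G \<omega>) (n + n) (\<rho> \<omega>) (\<rho> \<omega>)) *
      (INF m. no_coll (G \<omega>) m (\<rho> \<omega>) (\<rho> \<omega>))" for \<omega>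
  have loc: "(\<lambda>\<omega>. \<Phi> (G \<omega>) (\<rho> \<omega>) (\<rho> \<omega>)) \<in>
      borel_measurable M" if "local_functional \<Phi>"
    for \<Phi> :: "nat multigraph \<Rightarrow> nat \<Rightarrow> nat \<Rightarrow> ennreal"
    unfolding G_def \<rho>_def using measurable_compose[OF X borel_measurable_rooted[OF that]] .
  note [measurable] = local_functional_basic[THEN loc]
  have S: "S \<in> borel_measurable M" and R: "R \<in> borel_measurable M"
    unfolding S_def R_def by measurable
  have transport: "(\<integral>\<^sup>+\<omega>. S \<omega> \<partial>M) = (\<integral>\<^sup>+\<omega>. R \<omega> \<partial>M)"
  proof -
    let ?f = "\<lambda>z. case rep_birooted_graph z of (G, u, v) \<Rightarrow> meet_transport G u v"
    have "(\<integral>\<^sup>+v. ?f (birooted (G \<omega>) (\<rho> \<omega>) v) \<partial>count_space (verts (G \<omega>))) =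
        S \<omega>"
      "(\<integral>\<^sup>+u. ?f (birooted (G \<omega>) u (\<rho> \<omega>)) \<partial>count_space (verts (G \<omega>))) = R \<omega>" for \<omega>
      unfolding S_def R_def meet_transport_out[OF G, symmetric] meet_transport_in[OF G(1), symmetric]
      by (intro nn_integral_cong, use G meet_transport_birooted in simp)+
    then show ?thesis
      using assms(2) borel_measurable_meet_transport unfolding unimodular_def G_def \<rho>_def by auto
  qed
  have "S \<omega> \<le> of_nat (deg (G \<omega>) (\<rho> \<omega>))" for \<omega>
    using mult_left_mono[OF suminf_INF_last_coll_le_1, of "of_nat (deg (G \<omega>) (\<rho> \<omega>))"]
    by (simp add: S_def)
  then have "(\<integral>\<^sup>+\<omega>. S \<omega> \<partial>M) \<le>
      (\<integral>\<^sup>+\<omega>. of_nat (deg (G \<omega>) (\<rho> \<omega>)) \<partial>M)"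
    by (rule nn_integral_mono)
  also have "\<dots> < \<infinity>" using assms(4) by (simp add: G_def \<rho>_def)
  finally have "AE \<omega> in M. R \<omega> \<noteq> \<infinity>"
    using R transport by (intro nn_integral_PInf_AE) auto
  then have "AE \<omega> in M. R \<omega> = 0"
    using assms(3)
  proof eventually_elim
    case (elim \<omega>)
    show ?case
    proof (cases "deg (G \<omega>) (\<rho> \<omega>) = 0")
      case False
      have "(\<Sum>n. trans_prob (G \<omega>) (n + n) (\<rho> \<omega>) (\<rho> \<omega>)) = \<infinity>"
        using elim(2) G False by (intro suminf_even_trans_prob suminf_trans_prob_recurrent) (auto simp: G_def)
      \<comment> \<open>The degree is positive and the sum infinite, so finiteness of
        \<open>R\<close> forces the factor q(\<rho>) to vanish, and infinity times 0 is 0 in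
        \<open>ennreal\<close>.\<close>
      then show ?thesis
        using elim(1) False by (auto simp: R_def ennreal_mult_eq_top_iff)
    qed (simp add: R_def)
  qed
  then have "(\<integral>\<^sup>+\<omega>. S \<omega> \<partial>M) = 0"
    unfolding transport using R by (simp add: nn_integral_0_iff_AE)
  then have "AE \<omega> in M. S \<omega> = 0" using S by (simp add: nn_integral_0_iff_AE)
  then show ?thesis
  proof eventually_elim
    case (elim \<omega>)
    then have "infinite_collision_property (G \<omega>)"
      using infinite_collision_property_if_last_coll_0[OF G] infinite_collision_property_if_deg_0[OF G]
      by (auto simp: S_def)
    then show ?case by (simp add: G_def)
  qed
qed

end
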